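(* Let $X\in\{\mathcal{M}_n(\mathbb{F}),\mathcal{H}_n(\mathbb{F})\}$, let $(X,\|\cdot\|)$ be an admissible matrix space in $\mathcal{M}_n(\mathbb{F})$, let $(k,l)=(k(X),l(X))$, and let $(G,p)$, $G=(V,E)$, be a full and well-positioned bar-joint framework in $(X,\|\cdot\|)$. (i) If $(G,p)$ is infinitesimally rigid, then $|E|\ge k|V|-l$. (ii) If $(G,p)$ is minimally infinitesimally rigid, then $|E|=k|V|-l$. (iii) If $(G,p)$ is minimally infinitesimally rigid and $(H,p_H)$ is a full subframework of $(G,p)$, then $|E(H)|\le k|V(H)|-l$.
   Context: Matrix spaces. $n\ge 2$ is an integer, $\mathbb{F}\in\{\mathbb{R},\mathbb{C}\}$, $\mathcal{M}_n(\mathbb{F})$ is the space of $n\times n$ matrices over $\mathbb{F}$ and $\mathcal{H}_n(\mathbb{F})$ is the real space of hermitian (symmetric, if $\mathbb{F}=\mathbb{R}$) matrices. $\mathcal{U}_n(\mathbb{F})$ is the set of unitary (orthogonal) matrices, $a^*$ the conjugate transpose, $e_{ij}$ the matrix units. All spaces are regarded as real linear spaces. A norm on $\mathcal{M}_n(\mathbb{F})$ is unitarily invariant if $\|a\|=\|uaw\|$ for all $a$ and all $u,w\in\mathcal{U}_n(\mathbb{F})$. A test set is a finite set $\Gamma$ of real-linear maps $\mathcal{M}_n(\mathbb{F})\to\mathcal{M}_n(\mathbb{F})$ containing the identity and with $\gamma(I)=I$ for all $\gamma\in\Gamma$. For a real-linear subspace $X$, $X^\Gamma=\bigcup_{\gamma\in\Gamma}\{y\in\mathcal{M}_n(\mathbb{F}):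 xy=y\gamma(x)\ \forall x\in X\}$; $X$ is $\Gamma$-large if $I\in X$ and $X^\Gamma=\mathbb{F}I$. $(X,\|\cdot\|)$ has the $\Gamma$-isometry property if every real-linear isometry $A:X\to X$ has the form $A(x)=u\gamma(x)w$ with $u,w\in\mathcal{U}_n(\mathbb{F})$, $\gamma\in\Gamma$. $(X,\|\cdot\|)$, with $\|\cdot\|$ a unitarily invariant norm on $\mathcal{M}_n(\mathbb{F})$, is an admissible matrix space (in $\mathcal{M}_n(\mathbb{F})$) if (a) for some test set $\Gamma$, $X$ is $\Gamma$-large and $(X,\|\cdot\|)$ has the $\Gamma$-isometry property; (b) there are scalars $\lambda_i\in\mathbb{F}$ $(1\le i\le n)$ with $e_{ii}\in X$ and $e_{1i}+\lambda_ie_{i1}\in X$; (c) $x^*\in X$ for all $x\in X$. Values of $k(X),l(X)$: $\mathcal{H}_n(\mathbb{R})$: $k=\tfrac12n(n+1)$, $l=n^2$; $\mathcal{M}_n(\mathbb{R})$: $k=n^2$, $l=2n^2-n$; $\mathcal{H}_n(\mathbb{C})$: $k=n^2$, $l=2n^2-1$; $\mathcal{M}_n(\mathbb{C})$: $k=2n^2$, $l=4n^2-1$. Rigid motions. A rigid motion of a normed space $(X,\|\cdot\|)$ is a family of continuous paths $\{\alpha_x:[-1,1]\to X\}_{x\in X}$ with $\alpha_x(0)=x$, $\alpha_x$ differentiable at $0$, and $\|\alpha_x(t)-\alpha_y(t)\|=\|x-y\|$ for all $x,y\in X$, $t\in[-1,1]$. $\mathcal{T}(X,\|\cdot\|)$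 is the space of maps $\eta:X\to X$ of the form $\eta(x)=\alpha_x'(0)$ for a rigid motion $\alpha$. Frameworks. $G=(V,E)$ is a finite simple graph. A bar-joint framework $(G,p)$ in $X$ is $G$ with a map $p:V\to X$, $v\mapsto p_v$, such that $p_v\ne p_w$ for all $vw\in E$. A subframework $(H,p_H)$ consists of a subgraph $H=(V(H),E(H))$ of $G$ and $p_H=p|_{V(H)}$. A support functional for a unit vector $x_0\in X$ is a linear functional $f:X\to\mathbb{R}$ with $\|f\|\le 1$ and $f(x_0)=1$; the norm is smooth at $x\ne 0$ if $x/\|x\|$ has exactly one support functional. $(G,p)$ is well-positioned if the norm is smooth at $p_v-p_w$ for every $vw\in E$. A non-empty set $S\subseteq X$ is full in $(X,\|\cdot\|)$ if the map $\mathcal{T}(X,\|\cdot\|)\to X^S$, $\eta\mapsto(\eta(x))_{x\in S}$, is injective; $(G,p)$ is full if $\{p_v:v\in V\}$ is full. With $f_G:X^V\to\mathbb{R}^E$, $f_G((x_v)_{v\in V})=(\|x_v-x_w\|)_{vw\in E}$, an infinitesimal flex of $(G,p)$ is $z\in X^V$ with $\lim_{t\to0}\frac1t(f_G(p+tz)-f_G(p))=0$. It is trivial if $z=\eta\circ p$ for some $\eta\in\mathcal{T}(X,\|\cdot\|)$. $(G,p)$ is infinitesimally rigid if every infinitesimal flex is trivial, and infinitesimally flexible otherwise. It is minimally infinitesimally rigid if it is infinitesimally rigid and every subframework obtained by removing an edge from $G$ is infinitesimally flexible. *)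

theory Defs
  imports "HOL-Analysis.Analysis" "Jordan_Normal_Form.Conjugate"
begin

section \<open>Matrices over the reals or the complex numbers\<close>

text \<open>
  The scalar field is a type variable; the intended instances are \<^typ>\<open>real\<close>, where
  \<^const>\<open>conjugate\<close> is the identity, and \<^typ>\<open>complex\<close>, where it is \<^const>\<open>cnj\<close>.
  For \<^typ>\<open>real\<close> the words hermitian and unitary below mean symmetric and orthogonal.
\<close>

definition conj_transpose :: "'f::conjugate^'n^'m \<Rightarrow> 'f^'m^'n"
  where "conj_transpose a = map_matrix conjugate (transpose a)"

definition hermitian_matrices :: "('f::conjugate^'n^'n) set"
  where "hermitian_matrices = {a. conj_transpose a = a}"

definition unitary_matrices :: "('f::{conjugate,semiring_1}^'n^'n) set"
  where "unitary_matrices =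
    {u. conj_transpose u ** u = mat 1 \<and> u ** conj_transpose u = mat 1}"

definition matrix_unit :: "'n \<Rightarrow> 'n \<Rightarrow> 'f::zero_neq_one^'n^'n"
  where "matrix_unit i j = (\<chi> a b. if a = i \<and> b = j then 1 else 0)"


section \<open>Norms and real-linear maps on subspaces\<close>

text \<open>
  The norm under study is a function \<open>N\<close> on the ambient type and is unrelated to the type-class
  norm. It is a norm of real linear spaces. For complex matrices, unitary invariance makes it
  homogeneous for complex scalars as well.
\<close>

definition is_norm :: "('a::real_vector \<Rightarrow> real) \<Rightarrow> bool"
  where "is_norm N \<longleftrightarrow>
    (\<forall>x. 0 \<le> N x) \<and> (\<forall>x. N x = 0 \<longleftrightarrow> x = 0) \<and>
    (\<forall>c x. N (c *\<^sub>R x) = \<bar>c\<bar> * N x) \<and> (\<forall>x y. N (x + y) \<le> N x + N y)"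

definition unitarily_invariant ::
    "('f::{real_normed_field,conjugatable_field}^'n^'n \<Rightarrow> real) \<Rightarrow> bool"
  where "unitarily_invariant N \<longleftrightarrow>
    (\<forall>a. \<forall>u\<in>unitary_matrices. \<forall>w\<in>unitary_matrices. N (u ** a ** w) = N a)"

definition real_linear_on ::
    "'a::real_vector set \<Rightarrow> ('a \<Rightarrow> 'b::real_vector) \<Rightarrow> bool"
  where "real_linear_on X f \<longleftrightarrow>
    (\<forall>x\<in>X. \<forall>y\<in>X. f (x + y) = f x + f y) \<and> (\<forall>c. \<forall>x\<in>X. f (c *\<^sub>R x) = c *\<^sub>R f x)"


section \<open>Admissible matrix spaces\<close>

definition test_set ::
    "('f::{real_normed_field,conjugatable_field}^'n^'n \<Rightarrow> 'f^'n^'n) set \<Rightarrow> bool"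
  where "test_set \<Gamma> \<longleftrightarrow>
    finite \<Gamma> \<and> id \<in> \<Gamma> \<and> (\<forall>\<gamma>\<in>\<Gamma>. linear \<gamma> \<and> \<gamma> (mat 1) = mat 1)"

definition twisted_commutant ::
    "('f::{real_normed_field,conjugatable_field}^'n^'n \<Rightarrow> 'f^'n^'n) set \<Rightarrow>
      ('f^'n^'n) set \<Rightarrow> ('f^'n^'n) set"
  where "twisted_commutant \<Gamma> X = (\<Union>\<gamma>\<in>\<Gamma>. {y. \<forall>x\<in>X. x ** y = y ** \<gamma> x})"

definition test_large ::
    "('f::{real_normed_field,conjugatable_field}^'n^'n \<Rightarrow> 'f^'n^'n) set \<Rightarrow>
      ('f^'n^'n) set \<Rightarrow> bool"
  where "test_large \<Gamma> X \<longleftrightarrow> mat 1 \<in> X \<and> twisted_commutant \<Gamma> X = range mat"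

definition test_isometry_property ::
    "('f::{real_normed_field,conjugatable_field}^'n^'n \<Rightarrow> 'f^'n^'n) set \<Rightarrow>
      ('f^'n^'n) set \<Rightarrow> ('f^'n^'n \<Rightarrow> real) \<Rightarrow> bool"
  where "test_isometry_property \<Gamma> X N \<longleftrightarrow>
    (\<forall>A. real_linear_on X A \<and> A ` X \<subseteq> X \<and> (\<forall>x\<in>X. \<forall>y\<in>X. N (A x - A y) = N (x - y)) \<longrightarrow>
      (\<exists>u\<in>unitary_matrices. \<exists>w\<in>unitary_matrices. \<exists>\<gamma>\<in>\<Gamma>. \<forall>x\<in>X. A x = u ** \<gamma> x ** w))"

text \<open>
  The index set \<open>{1, \<dots>, n}\<close> is a finite type \<^typ>\<open>'n\<close>, which has no distinguished first
  element; the parameter \<open>one\<close> is the element of \<^typ>\<open>'n\<close> that plays the role of the index 1.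
\<close>

definition admissible_matrix_space ::
    "'n \<Rightarrow> ('f::{real_normed_field,conjugatable_field}^'n^'n) set \<Rightarrow>
      ('f^'n^'n \<Rightarrow> real) \<Rightarrow> bool"
  where "admissible_matrix_space one X N \<longleftrightarrow>
    subspace X \<and> is_norm N \<and> unitarily_invariant N \<and>
    (\<exists>\<Gamma>. test_set \<Gamma> \<and> test_large \<Gamma> X \<and> test_isometry_property \<Gamma> X N) \<and>
    (\<exists>lam :: 'n \<Rightarrow> 'f. \<forall>i. matrix_unit i i \<in> X \<and>
       matrix_unit one i + map_matrix ((*) (lam i)) (matrix_unit i one) \<in> X) \<and>
    (\<forall>x\<in>X. conj_transpose x \<in> X)"


section \<open>Rigid motions\<close>

text \<open>
  A normed space \<open>(X, N)\<close> is a linear subspace \<open>X\<close> of a finite-dimensional type with a norm \<open>N\<close>.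
  All norms on such a type are equivalent, so continuity and differentiability are those of
  the type. A family of paths indexed by \<open>X\<close> is a total function of which only the values at
  points of \<open>X\<close> and times in \<open>[-1, 1]\<close> matter.
\<close>

definition rigid_motion ::
    "'a::euclidean_space set \<Rightarrow> ('a \<Rightarrow> real) \<Rightarrow> ('a \<Rightarrow> real \<Rightarrow> 'a) \<Rightarrow> bool"
  where "rigid_motion X N \<alpha> \<longleftrightarrow>
    (\<forall>x\<in>X. continuous_on {-1..1} (\<alpha> x) \<and> \<alpha> x ` {-1..1} \<subseteq> X \<and>
       \<alpha> x 0 = x \<and> \<alpha> x differentiable (at 0)) \<and>
    (\<forall>x\<in>X. \<forall>y\<in>X. \<forall>t\<in>{-1..1}. N (\<alpha> x t - \<alpha> y t) = N (x - y))"

text \<open>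
  Maps on \<open>X\<close> are extensional, so that equality of functions is equality on \<open>X\<close>.
\<close>

definition rigid_velocities ::
    "'a::euclidean_space set \<Rightarrow> ('a \<Rightarrow> real) \<Rightarrow> ('a \<Rightarrow> 'a) set"
  where "rigid_velocities X N =
    {(\<lambda>x\<in>X. vector_derivative (\<alpha> x) (at 0)) |\<alpha>. rigid_motion X N \<alpha>}"

definition full_set :: "'a::euclidean_space set \<Rightarrow> ('a \<Rightarrow> real) \<Rightarrow> 'a set \<Rightarrow> bool"
  where "full_set X N S \<longleftrightarrow>
    S \<noteq> {} \<and> S \<subseteq> X \<and> inj_on (\<lambda>\<eta>. restrict \<eta> S) (rigid_velocities X N)"


section \<open>Smooth points\<close>

text \<open>
  The bound \<open>\<bar>f x\<bar> \<le> N x\<close> says that the operator norm of \<open>f\<close> is at most 1.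
\<close>

definition support_functional ::
    "'a::euclidean_space set \<Rightarrow> ('a \<Rightarrow> real) \<Rightarrow> 'a \<Rightarrow> ('a \<Rightarrow> real) \<Rightarrow> bool"
  where "support_functional X N x0 f \<longleftrightarrow>
    f \<in> extensional X \<and> real_linear_on X f \<and> (\<forall>x\<in>X. \<bar>f x\<bar> \<le> N x) \<and> f x0 = 1"

definition smooth_at :: "'a::euclidean_space set \<Rightarrow> ('a \<Rightarrow> real) \<Rightarrow> 'a \<Rightarrow> bool"
  where "smooth_at X N x \<longleftrightarrow>
    x \<in> X \<and> x \<noteq> 0 \<and> (\<exists>!f. support_functional X N (x /\<^sub>R N x) f)"


section \<open>Graphs and frameworks\<close>

definition finite_simple_graph :: "'v set \<Rightarrow> 'v set set \<Rightarrow> bool"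
  where "finite_simple_graph V E \<longleftrightarrow> finite V \<and> (\<forall>e\<in>E. e \<subseteq> V \<and> card e = 2)"

definition is_subgraph :: "'v set \<Rightarrow> 'v set set \<Rightarrow> 'v set \<Rightarrow> 'v set set \<Rightarrow> bool"
  where "is_subgraph VH EH V E \<longleftrightarrow> finite_simple_graph VH EH \<and> VH \<subseteq> V \<and> EH \<subseteq> E"

definition framework ::
    "'a set \<Rightarrow> 'v set \<Rightarrow> 'v set set \<Rightarrow> ('v \<Rightarrow> 'a) \<Rightarrow> bool"
  where "framework X V E p \<longleftrightarrow> p ` V \<subseteq> X \<and> (\<forall>v w. {v, w} \<in> E \<longrightarrow> p v \<noteq> p w)"

definition well_positioned ::
    "'a::euclidean_space set \<Rightarrow> ('a \<Rightarrow> real) \<Rightarrow> 'v set set \<Rightarrow> ('v \<Rightarrow> 'a) \<Rightarrow> bool"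
  where "well_positioned X N E p \<longleftrightarrow> (\<forall>v w. {v, w} \<in> E \<longrightarrow> smooth_at X N (p v - p w))"

definition full_framework ::
    "'a::euclidean_space set \<Rightarrow> ('a \<Rightarrow> real) \<Rightarrow> 'v set \<Rightarrow> ('v \<Rightarrow> 'a) \<Rightarrow> bool"
  where "full_framework X N V p \<longleftrightarrow> full_set X N (p ` V)"

text \<open>
  The limit of the difference quotients of the edge-length map is taken edge by edge.
\<close>

definition infinitesimal_flex ::
    "'a::euclidean_space set \<Rightarrow> ('a \<Rightarrow> real) \<Rightarrow> 'v set \<Rightarrow> 'v set set \<Rightarrow> ('v \<Rightarrow> 'a) \<Rightarrow>
      ('v \<Rightarrow> 'a) \<Rightarrow> bool"
  where "infinitesimal_flex X N V E p z \<longleftrightarrow>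
    z ` V \<subseteq> X \<and>
    (\<forall>v w. {v, w} \<in> E \<longrightarrow>
      ((\<lambda>t. (N ((p v + t *\<^sub>R z v) - (p w + t *\<^sub>R z w)) - N (p v - p w)) / t) \<longlongrightarrow> 0) (at 0))"

definition trivial_flex ::
    "'a::euclidean_space set \<Rightarrow> ('a \<Rightarrow> real) \<Rightarrow> 'v set \<Rightarrow> ('v \<Rightarrow> 'a) \<Rightarrow> ('v \<Rightarrow> 'a) \<Rightarrow> bool"
  where "trivial_flex X N V p z \<longleftrightarrow> (\<exists>\<eta>\<in>rigid_velocities X N. \<forall>v\<in>V. z v = \<eta> (p v))"

definition infinitesimally_rigid ::
    "'a::euclidean_space set \<Rightarrow> ('a \<Rightarrow> real) \<Rightarrow> 'v set \<Rightarrow> 'v set set \<Rightarrow> ('v \<Rightarrow> 'a) \<Rightarrow> bool"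
  where "infinitesimally_rigid X N V E p \<longleftrightarrow>
    (\<forall>z. infinitesimal_flex X N V E p z \<longrightarrow> trivial_flex X N V p z)"

definition minimally_infinitesimally_rigid ::
    "'a::euclidean_space set \<Rightarrow> ('a \<Rightarrow> real) \<Rightarrow> 'v set \<Rightarrow> 'v set set \<Rightarrow> ('v \<Rightarrow> 'a) \<Rightarrow> bool"
  where "minimally_infinitesimally_rigid X N V E p \<longleftrightarrow>
    infinitesimally_rigid X N V E p \<and>
    (\<forall>e\<in>E. \<not> infinitesimally_rigid X N V (E - {e}) p)"

end

theory Submission
  imports Defs "HOL-Library.Function_Algebras"
begin

text \<open>
  Write \<open>k\<close> for the dimension of \<open>X\<close> and \<open>l\<close> for the dimension of the space of velocities of rigid
  motions. Placements of the vertex set \<open>V\<close> form a space of dimension \<open>k |V|\<close>, every edge imposes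
  one linear condition on infinitesimal flexes because the norm is smooth at its direction, and
  for a full framework the trivial flexes form a space of dimension \<open>l\<close>. Rigidity says that the
  edge conditions cut out exactly the trivial flexes, so at least \<open>k |V| - l\<close> edges are needed.
  Minimality says that no condition follows from the others, so every edge lowers the dimension
  by exactly one. This gives equality, and, since the conditions of a subframework are
  independent as well, the bound for full subframeworks (\<open>rigidity_counts\<close>).

  The remaining task is to determine the velocities of rigid motions. At a fixed time a rigid
  motion is an isometry of \<open>X\<close>, hence affine (\<open>mazur_ulam\<close>; surjectivity follows from
  invariance of domain), and its linear part has the form \<open>x \<mapsto> u \<gamma>(x) w\<close> by the isometry property.
  Along a sequence of times tending to 0 a single \<open>\<gamma>\<close> occurs and \<open>u\<close>, \<open>w\<close> converge; the limit is
  the identity, and largeness of \<open>X\<close> forces \<open>\<gamma>\<close> to be the identity on \<open>X\<close>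
  (\<open>rigid_motion_unitary_sequence\<close>). Up to the derivative of \<open>u w\<close>, which is skew-hermitian, the
  velocity is therefore a limit of difference quotients of conjugations \<open>x \<mapsto> u x u\<^sup>*\<close>. The individual
  matrices \<open>u\<close> need not be differentiable, since scalar phases are free, but the matrices at which
  the quotients converge form a ring; it contains the hermitian matrices and hence all matrices,
  and the limit is a derivation compatible with the conjugate transpose. Such a derivation is
  \<open>x \<mapsto> a x - x a\<close> with \<open>a\<close> skew-hermitian (\<open>unitary_conjugations_derivative\<close>). Conversely, every
  skew-hermitian matrix is the velocity at the identity of a path of unitary matrices, given by
  the Cayley transform. So the velocities are the maps \<open>x \<mapsto> c + a x + x b\<close> with \<open>a\<close>, \<open>b\<close>
  skew-hermitian, where \<open>b = - a\<close> if \<open>X\<close> consists of the hermitian matrices; the only redundancy in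
  the parameters \<open>(c, a, b)\<close> comes from scalar matrices, which is removed by prescribing one
  diagonal entry to be 0. Counting dimensions of skew-hermitian and hermitian matrices yields the
  values of \<open>k\<close> and \<open>l\<close>.
\<close>

section \<open>Dimensions of subspaces of function spaces\<close>

text \<open>
  Placements and flexes of a framework are functions from vertices to points. Pointwise scaling
  makes \<^const>\<open>dim\<close>, \<^const>\<open>span\<close> and \<^const>\<open>linear\<close> available for them for an arbitrary type of
  vertices; only finite-dimensional subspaces occur.
\<close>
instantiation "fun" :: (type, real_vector) real_vector
begin
definition scaleR_fun :: "real \<Rightarrow> ('a \<Rightarrow> 'b) \<Rightarrow> 'a \<Rightarrow> 'b"
  where "scaleR_fun r f = (\<lambda>x. r *\<^sub>R f x)"
instance
  by standard (simp_all add: scaleR_fun_def fun_eq_iff algebra_simps)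
end

lemma scaleR_fun_apply [simp]: "(r *\<^sub>R f) x = r *\<^sub>R f x"
  by (simp add: scaleR_fun_def)

text \<open>
  A type of functions need not be finite-dimensional as a whole, so finiteness of the dimension is
  a property of the subspace under consideration.
\<close>
definition finite_dim :: "'a::real_vector set \<Rightarrow> bool"
  where "finite_dim S \<longleftrightarrow> (\<exists>B. finite B \<and> S \<subseteq> span B)"

lemma finite_dim_independent:
  assumes "finite_dim S" "independent B" "B \<subseteq> S"
  shows "finite B"
  using assms independent_span_bound unfolding finite_dim_def by blast

lemma finite_dim_subset: "finite_dim T \<Longrightarrow> S \<subseteq> T \<Longrightarrow> finite_dim S"
  unfolding finite_dim_def by blast

lemma finite_dim_euclidean [simp]: "finite_dim (S :: 'a::euclidean_space set)"
  unfolding finite_dim_def using finite_Basis span_Basis by blast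

lemma finite_dim_basis:
  assumes "finite_dim S"
  obtains B where "B \<subseteq> S" "independent B" "S \<subseteq> span B" "finite B" "card B = dim S"
proof -
  obtain B where "B \<subseteq> S" "independent B" "S \<subseteq> span B"
    using maximal_independent_subset by blast
  with finite_dim_independent[OF assms] basis_card_eq_dim show thesis
    by (metis that)
qed

lemma dim_mono_finite:
  assumes "S \<subseteq> T" "finite_dim T"
  shows "dim S \<le> dim T"
proof -
  obtain B where "T \<subseteq> span B" "finite B" "card B = dim T"
    using finite_dim_basis[OF assms(2)] by metis
  with assms(1) dim_le_card[of S B] show ?thesis by auto
qed

lemma span_disjoint_of_independent:
  assumes "independent B" "C \<subseteq> B" "D \<subseteq> B" "C \<inter> D = {}" "x \<in> span C" "x \<in> span D"
  shows "x = (0::'a::real_vector)"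
proof -
  have "real_vector.representation B x b = 0" for b
    using real_vector.representation_extend[OF assms(1,5,2)]
      real_vector.representation_extend[OF assms(1,6,3)]
      real_vector.representation_ne_zero assms(4) by (metis disjoint_iff)
  moreover have "x \<in> span B"
    using assms span_mono by blast
  ultimately show ?thesis
    using real_vector.sum_nonzero_representation_eq[OF assms(1)] by fastforce
qed

lemma rank_nullity:
  fixes f :: "'a::real_vector \<Rightarrow> 'b::real_vector"
  assumes f: "linear f" and S: "subspace S" "finite_dim S"
  shows "dim S = dim {x\<in>S. f x = 0} + dim (f ` S)"
proof -
  interpret f: linear f by fact
  define K where "K = {x\<in>S. f x = 0}"
  obtain C where C: "C \<subseteq> K" "independent C" "K \<subseteq> span C"
    using maximal_independent_subset by blast
  obtain B where B: "C \<subseteq> B" "B \<subseteq> S" "independent B" "S \<subseteq> span B"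
    using maximal_independent_subset_extend[of C S] C K_def by blast
  have finB: "finite B"
    using finite_dim_independent[OF S(2) B(3,2)] .
  have dimS: "card B = dim S" and dimK: "card C = dim K"
    using basis_card_eq_dim B C by auto
  have span_S: "span B \<subseteq> S"
    using B(2) S(1) by (simp add: span_minimal)
  have inj: "inj_on f (span (B - C))"
  proof (subst linear_injective_on_subspace_0[OF f subspace_span], intro ballI impI)
    fix x assume x: "x \<in> span (B - C)" "f x = 0"
    then have "x \<in> span C"
      using C(3) span_S span_mono[of "B - C" B] unfolding K_def by auto
    then show "x = 0"
      using x(1) B(1,3) span_disjoint_of_independent[of B C "B - C"] by auto
  qed
  have "f ` S \<subseteq> span (f ` (B - C))"
  proof
    fix y assume "y \<in> f ` S"
    then obtain x where x: "x \<in> span ((B - C) \<union> C)" "y = f x"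
      using B(1,4) by (auto simp: Un_absorb2 sup.absorb1)
    then obtain u v where uv: "x = u + v" "u \<in> span (B - C)" "v \<in> span C"
      unfolding span_Un by blast
    have "f v = 0"
      using span_minimal[of C "{x. f x = 0}"] C(1) uv(3) linear_subspace_kernel[OF f]
      unfolding K_def by blast
    then have "f x = f u"
      using uv by (auto simp: f.add)
    then show "y \<in> span (f ` (B - C))"
      using uv x linear_span_image[OF f] by auto
  qed
  moreover have "independent (f ` (B - C))"
    by (intro linear_independent_injective_image[OF f]) (meson B(3) Diff_subset independent_mono, rule inj)
  moreover have "f ` (B - C) \<subseteq> f ` S"
    using B(2) by blast
  ultimately have "dim (f ` S) = card (f ` (B - C))"
    using basis_card_eq_dim by metis
  also have "\<dots> = card (B - C)"
    using inj by (meson card_image inj_on_subset span_superset)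
  also have "\<dots> = card B - card C"
    using B(1) finB by (metis card_Diff_subset finite_subset)
  finally have "dim (f ` S) = card B - card C" .
  moreover have "card C \<le> card B"
    using B(1) finB by (simp add: card_mono)
  ultimately show ?thesis
    using dimS dimK unfolding K_def by linarith
qed

corollary dim_linear_image_inj:
  assumes "linear f" "subspace S" "finite_dim S" "\<And>x. x \<in> S \<Longrightarrow> f x = 0 \<Longrightarrow> x = 0"
  shows "dim (f ` S) = dim S"
proof -
  have "dim {x\<in>S. f x = 0} = 0"
    using dim_le_card[of "{x\<in>S. f x = 0}" "{}"] assms(4) by auto
  then show ?thesis
    using rank_nullity[OF assms(1-3)] by simp
qed

lemma finite_dim_from_rank_nullity:
  fixes f :: "'a::real_vector \<Rightarrow> 'b::real_vector"
  assumes f: "linear f" "finite_dim {x\<in>S. f x = 0}" "finite_dim (f ` S)" and S: "subspace S"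
  shows "finite_dim S"
proof -
  interpret f: linear f by fact
  obtain C where C: "finite C" "{x\<in>S. f x = 0} \<subseteq> span C"
    using f(2) unfolding finite_dim_def by blast
  obtain D where D: "finite D" "D \<subseteq> f ` S" "f ` S \<subseteq> span D"
    using finite_dim_basis[OF f(3)] by metis
  then obtain D' where D': "finite D'" "D' \<subseteq> S" "D = f ` D'"
    by (meson finite_subset_image)
  have "S \<subseteq> span (C \<union> D')"
  proof
    fix x assume x: "x \<in> S"
    have "f ` S \<subseteq> f ` span D'"
      using D(3) D'(3) by (simp add: linear_span_image[OF f(1)])
    then obtain y where y: "y \<in> span D'" "f x = f y"
      using x by auto
    have "y \<in> S"
      using y(1) D'(2) S span_minimal by blast
    then have "x - y \<in> span C"
      using C(2) x y(2) S by (auto simp: f.diff subspace_diff)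
    then have "(x - y) + y \<in> span (C \<union> D')"
      using y(1) by (meson span_add span_mono subsetD sup_ge1 sup_ge2)
    then show "x \<in> span (C \<union> D')" by simp
  qed
  then show ?thesis
    unfolding finite_dim_def using C(1) D'(1) by blast
qed

definition functions_on :: "'v set \<Rightarrow> 'a::real_vector set \<Rightarrow> ('v \<Rightarrow> 'a) set"
  where "functions_on V X = {z. (\<forall>v\<in>V. z v \<in> X) \<and> (\<forall>v. v \<notin> V \<longrightarrow> z v = 0)}"

lemma subspace_functions_on: "subspace X \<Longrightarrow> subspace (functions_on V X)"
  unfolding functions_on_def subspace_def by auto

lemma linear_eval: "linear (\<lambda>z. z v)"
  by (auto intro: linearI)

text \<open>
  Evaluation at a new vertex maps the space onto \<open>X\<close> and has the functions on the old vertices as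
  its kernel.
\<close>
lemma dim_functions_on:
  fixes V :: "'v set" and X :: "'a::real_vector set"
  assumes "finite V" "subspace X" "finite_dim X"
  shows "finite_dim (functions_on V X) \<and> dim (functions_on V X) = card V * dim X"
  using assms(1)
proof (induction V)
  case empty
  have "functions_on ({} :: 'v set) X = {0}"
    unfolding functions_on_def by (auto simp: fun_eq_iff)
  moreover have "dim {0 :: 'v \<Rightarrow> 'a} = 0"
    using dim_le_card[of "{0 :: 'v \<Rightarrow> 'a}" "{}"] by simp
  moreover have "finite_dim {0 :: 'v \<Rightarrow> 'a}"
    unfolding finite_dim_def by (rule exI[of _ "{}"]) simp
  ultimately show ?case by simp
next
  case (insert v V)
  have ker: "{z\<in>functions_on (insert v V) X. z v = 0} = functions_on V X"
    using insert.hyps(2) subspace_0[OF assms(2)] unfolding functions_on_def by fastforce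
  have img: "(\<lambda>z. z v) ` functions_on (insert v V) X = X"
  proof
    show "X \<subseteq> (\<lambda>z. z v) ` functions_on (insert v V) X"
    proof
      fix x assume "x \<in> X"
      then have "(\<lambda>w. if w = v then x else 0) \<in> functions_on (insert v V) X"
        using subspace_0[OF assms(2)] unfolding functions_on_def by auto
      then show "x \<in> (\<lambda>z. z v) ` functions_on (insert v V) X"
        by (rule rev_image_eqI) simp
    qed
  qed (auto simp: functions_on_def)
  have fd: "finite_dim (functions_on (insert v V) X)"
    by (rule finite_dim_from_rank_nullity[OF linear_eval[of v]])
      (use ker img insert.IH assms subspace_functions_on in auto)
  then show ?case
    using rank_nullity[OF linear_eval[of v] subspace_functions_on[OF assms(2)] fd]
      ker img insert by simp
qed

section \<open>Smooth points of a norm\<close>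

lemma is_normD:
  assumes "is_norm N"
  shows "0 \<le> N x" "N x = 0 \<longleftrightarrow> x = 0" "N (c *\<^sub>R x) = \<bar>c\<bar> * N x" "N (x + y) \<le> N x + N y"
    "N 0 = 0" "N (- x) = N x" "N (x - y) = N (y - x)" "N x \<le> N y + N (x - y)"
proof -
  show N: "0 \<le> N x" "N x = 0 \<longleftrightarrow> x = 0" "N (c *\<^sub>R x) = \<bar>c\<bar> * N x" "N (x + y) \<le> N x + N y"
    for x y c
    using assms unfolding is_norm_def by auto
  show "N 0 = 0" using N(2) by simp
  show minus: "N (- x) = N x" for x
    using N(3)[of "-1" x] by simp
  show "N (x - y) = N (y - x)"
    using minus[of "x - y"] by simp
  show "N x \<le> N y + N (x - y)"
    using N(4)[of y "x - y"] by simp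
qed

lemma norm_upper_bound:
  fixes N :: "'a::euclidean_space \<Rightarrow> real"
  assumes "is_norm N"
  obtains C where "C > 0" "\<And>x. N x \<le> C * norm x"
proof
  note N = is_normD[OF assms]
  define C where "C = (\<Sum>b\<in>Basis. N b) + 1"
  have sum: "N (\<Sum>b\<in>B. f b) \<le> (\<Sum>b\<in>B. N (f b))" if "finite B" for f and B :: "'a set"
    using that
  proof (induction B)
    case (insert b B)
    then show ?case using N(4)[of "f b" "sum f B"] by simp
  qed (simp add: N(5))
  show "C > 0"
    unfolding C_def using sum_nonneg[of Basis N] N(1) by (simp add: add_nonneg_pos)
  show "N x \<le> C * norm x" for x
  proof -
    have "N x = N (\<Sum>b\<in>Basis. (x \<bullet> b) *\<^sub>R b)"
      by (simp add: euclidean_representation)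
    also have "\<dots> \<le> (\<Sum>b\<in>Basis. N ((x \<bullet> b) *\<^sub>R b))"
      by (rule sum) simp
    also have "\<dots> \<le> (\<Sum>b\<in>Basis. norm x * N b)"
      using N(1) by (intro sum_mono) (auto simp: N(3) intro!: mult_right_mono Basis_le_norm)
    also have "\<dots> = norm x * (\<Sum>b\<in>Basis. N b)"
      by (rule sum_distrib_left[symmetric])
    also have "\<dots> \<le> C * norm x"
      unfolding C_def by (simp add: algebra_simps)
    finally show ?thesis .
  qed
qed

lemma continuous_on_is_norm:
  fixes N :: "'a::euclidean_space \<Rightarrow> real"
  assumes "is_norm N"
  shows "continuous_on S N"
proof -
  obtain C where C: "C > 0" "\<And>x. N x \<le> C * norm x"
    using norm_upper_bound[OF assms] by blast
  have "\<bar>N x - N y\<bar> \<le> C * norm (x - y)" for x y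
    using is_normD(7,8)[OF assms, of x y] is_normD(8)[OF assms, of y x] C(2)[of "x - y"] by linarith
  then have "C-lipschitz_on S N"
    using C(1) by (intro lipschitz_onI) (auto simp: dist_norm)
  then show ?thesis
    by (rule lipschitz_on_continuous_on)
qed

lemma tendsto_is_norm:
  fixes N :: "'a::euclidean_space \<Rightarrow> real"
  assumes "is_norm N" "(f \<longlongrightarrow> l) F"
  shows "((\<lambda>x. N (f x)) \<longlongrightarrow> N l) F"
  using continuous_on_tendsto_compose[OF continuous_on_is_norm[OF assms(1), of UNIV] assms(2)] by simp

lemma norm_lower_bound:
  fixes N :: "'a::euclidean_space \<Rightarrow> real"
  assumes "is_norm N"
  obtains c where "c > 0" "\<And>x. c * norm x \<le> N x"
proof -
  note N = is_normD[OF assms]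
  have "compact (sphere 0 1 :: 'a set)" "(sphere 0 1 :: 'a set) \<noteq> {}"
    by auto
  then obtain u where u: "u \<in> sphere 0 1" "\<And>y. y \<in> sphere 0 1 \<Longrightarrow> N u \<le> N y"
    using continuous_attains_inf[OF _ _ continuous_on_is_norm[OF assms]] by metis
  show thesis
  proof
    have "u \<noteq> 0" using u(1) by auto
    then show "N u > 0" using N(1,2) by (metis less_eq_real_def)
    show "N u * norm x \<le> N x" for x
    proof (cases "x = 0")
      case False
      then have "N u \<le> N ((1 / norm x) *\<^sub>R x)"
        by (intro u(2)) simp
      then show ?thesis
        using False by (simp add: N(3) field_simps)
    qed (simp add: N(5))
  qed
qed

text \<open>
  Linear functionals are represented by vectors through the inner product, so this is the unit
  ball of the dual norm. Its compactness is what makes support functionals vary continuously at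
  smooth points.
\<close>
definition dual_ball :: "('a::euclidean_space \<Rightarrow> real) \<Rightarrow> 'a set"
  where "dual_ball N = {a. \<forall>x. \<bar>a \<bullet> x\<bar> \<le> N x}"

lemma compact_dual_ball:
  assumes "is_norm N"
  shows "compact (dual_ball N)"
proof -
  obtain C where C: "C > 0" "\<And>x. N x \<le> C * norm x"
    using norm_upper_bound[OF assms] by blast
  have "norm a \<le> C" if "a \<in> dual_ball N" for a
  proof -
    have "a \<bullet> a \<le> C * norm a"
      using that C(2)[of a] unfolding dual_ball_def by (smt (verit) mem_Collect_eq)
    then have "norm a * norm a \<le> C * norm a"
      by (simp add: dot_square_norm power2_eq_square)
    then show ?thesis
      using C(1) by (cases "a = 0") auto
  qed
  then have "bounded (dual_ball N)"
    by (auto simp: bounded_iff)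
  moreover have "dual_ball N = (\<Inter>x. {a. \<bar>a \<bullet> x\<bar> \<le> N x})"
    unfolding dual_ball_def by auto
  then have "closed (dual_ball N)"
    by (auto intro!: closed_INT closed_Collect_le continuous_intros)
  ultimately show ?thesis
    by (simp add: compact_eq_bounded_closed)
qed

text \<open>
  The finite-dimensional Hahn-Banach theorem: a hyperplane separates \<open>y\<close> from the open ball with
  radius \<open>N y\<close>, and its normal vector can be scaled to have dual norm 1.
\<close>
lemma dual_ball_attains_norm:
  fixes N :: "'a::euclidean_space \<Rightarrow> real"
  assumes "is_norm N"
  obtains a where "a \<in> dual_ball N" "a \<bullet> y = N y"
proof (cases "y = 0")
  case True
  then show thesis
    using that[of 0] is_normD(1,5)[OF assms] by (auto simp: dual_ball_def)
next
  case False
  note N = is_normD[OF assms]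
  have Ny: "N y > 0" using N(1,2) False by (metis less_eq_real_def)
  have "convex {x. N x < N y}"
  proof (rule convexI)
    fix x z and u v :: real
    assume *: "x \<in> {x. N x < N y}" "z \<in> {x. N x < N y}" "0 \<le> u" "0 \<le> v" "u + v = 1"
    have "N (u *\<^sub>R x + v *\<^sub>R z) \<le> u * N x + v * N z"
      using N(4)[of "u *\<^sub>R x" "v *\<^sub>R z"] *(3,4) by (simp add: N(3))
    also have "\<dots> < N y"
      using convex_bound_lt[of "N x" "N y" "N z" u v] * by simp
    finally show "u *\<^sub>R x + v *\<^sub>R z \<in> {x. N x < N y}" by simp
  qed
  moreover have "{x. N x < N y} \<noteq> {}" using Ny N(5) by (metis empty_iff mem_Collect_eq)
  ultimately obtain a b where ab: "a \<noteq> 0" "\<And>x. N x < N y \<Longrightarrow> a \<bullet> x \<le> b" "b \<le> a \<bullet> y"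
    using separating_hyperplane_sets[of "{x. N x < N y}" "{y}"] by auto
  have le: "a \<bullet> x * N y \<le> a \<bullet> y * N x" for x
  proof (cases "x = 0")
    case False
    then have Nx: "N x > 0" using N(1,2) by (metis less_eq_real_def)
    have "s * (a \<bullet> (N y *\<^sub>R x)) \<le> a \<bullet> (N x *\<^sub>R y)" if s: "0 < s" "s < 1" for s
    proof -
      have "N ((s * N y / N x) *\<^sub>R x) < N y"
        using s Nx Ny by (simp add: N(3))
      then have "a \<bullet> ((s * N y / N x) *\<^sub>R x) \<le> a \<bullet> y"
        using ab(2,3) by (meson order_trans)
      then show ?thesis
        using Nx by (simp add: field_simps)
    qed
    then have "a \<bullet> (N y *\<^sub>R x) \<le> a \<bullet> (N x *\<^sub>R y)"
      by (rule field_le_mult_one_interval)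
    then show ?thesis by (simp add: algebra_simps)
  qed (simp add: N(5))
  have Na: "N a > 0" using N(1,2) ab(1) by (metis less_eq_real_def)
  have "(a \<bullet> a) * N y \<le> a \<bullet> y * N a" by (rule le)
  moreover have "(a \<bullet> a) * N y > 0" using ab(1) Ny by simp
  ultimately have ay: "a \<bullet> y > 0" using Na by (meson less_le_trans zero_less_mult_pos2)
  show thesis
  proof
    have *: "((N y / (a \<bullet> y)) *\<^sub>R a) \<bullet> x \<le> N x" for x
      using le[of x] ay by (simp add: field_simps)
    show "(N y / (a \<bullet> y)) *\<^sub>R a \<in> dual_ball N"
      unfolding dual_ball_def
    proof (intro CollectI allI)
      fix x
      show "\<bar>((N y / (a \<bullet> y)) *\<^sub>R a) \<bullet> x\<bar> \<le> N x"
        using *[of x] *[of "- x"] by (simp add: N(6) abs_le_iff)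
    qed
    show "((N y / (a \<bullet> y)) *\<^sub>R a) \<bullet> y = N y"
      using ay by simp
  qed
qed

text \<open>
  Smoothness is a property of the subspace \<open>X\<close>, whereas the dual ball belongs to the ambient space.
  Functionals of norm 1 at \<open>x\<close> therefore agree on \<open>X\<close> but may differ outside.
\<close>
lemma smooth_at_functional_unique:
  assumes "is_norm N" "smooth_at X N x" "subspace X"
    and "a \<in> dual_ball N" "a \<bullet> x = N x" "b \<in> dual_ball N" "b \<bullet> x = N x" "h \<in> X"
  shows "a \<bullet> h = b \<bullet> h"
proof -
  have x: "x \<in> X" "N x \<noteq> 0"
    using assms(1,2) is_normD(2) unfolding smooth_at_def by blast+
  have "support_functional X N (x /\<^sub>R N x) (\<lambda>h\<in>X. c \<bullet> h)"
    if "c \<in> dual_ball N" "c \<bullet> x = N x" for c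
    using that x assms(3) unfolding support_functional_def real_linear_on_def dual_ball_def
    by (auto simp: subspace_add subspace_scale inner_right_distrib)
  then have "(\<lambda>h\<in>X. a \<bullet> h) = (\<lambda>h\<in>X. b \<bullet> h)"
    using assms unfolding smooth_at_def by blast
  then show ?thesis
    using assms(8) by (metis restrict_apply')
qed

text \<open>
  Let \<open>g t\<close> be a support functional at \<open>x + t h\<close> and \<open>a\<close> one at \<open>x\<close>. Convexity places the difference
  quotient between the values of \<open>a\<close> and \<open>g t\<close> at \<open>h\<close>. Every limit point of \<open>g t\<close> for \<open>t \<rightarrow> 0\<close> supports
  the ball at \<open>x\<close>, so by uniqueness \<open>g t h\<close> tends to \<open>a h\<close>.
\<close>
lemma smooth_at_gateaux:
  fixes N :: "'a::euclidean_space \<Rightarrow> real"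
  assumes N: "is_norm N" and smooth: "smooth_at X N x" and X: "subspace X"
  shows "\<exists>a. \<forall>h\<in>X. ((\<lambda>t. (N (x + t *\<^sub>R h) - N x) / t) \<longlongrightarrow> a \<bullet> h) (at 0)"
proof -
  obtain a where a: "a \<in> dual_ball N" "a \<bullet> x = N x"
    using dual_ball_attains_norm[OF N] by blast
  have "((\<lambda>t. (N (x + t *\<^sub>R h) - N x) / t) \<longlongrightarrow> a \<bullet> h) (at 0)" if h: "h \<in> X" for h
  proof -
    have "\<exists>b. b \<in> dual_ball N \<and> b \<bullet> (x + t *\<^sub>R h) = N (x + t *\<^sub>R h)" for t
      by (rule dual_ball_attains_norm[OF N]) blast
    then obtain g where g: "\<And>t. g t \<in> dual_ball N" "\<And>t. g t \<bullet> (x + t *\<^sub>R h) = N (x + t *\<^sub>R h)"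
      using dual_ball_attains_norm[OF N] by metis
    have between: "\<bar>(N (x + t *\<^sub>R h) - N x) / t - a \<bullet> h\<bar> \<le> \<bar>g t \<bullet> h - a \<bullet> h\<bar>" if "t \<noteq> 0" for t
    proof -
      have "N (x + t *\<^sub>R h) - N x \<le> t * (g t \<bullet> h)"
        using g(1)[of t] g(2)[of t] unfolding dual_ball_def
        by (simp add: inner_right_distrib) (smt (verit))
      moreover have "t * (a \<bullet> h) \<le> N (x + t *\<^sub>R h) - N x"
      proof -
        have "a \<bullet> (x + t *\<^sub>R h) \<le> N (x + t *\<^sub>R h)"
          using a(1) unfolding dual_ball_def by (smt (verit) mem_Collect_eq)
        then show ?thesis using a(2) by (simp add: inner_right_distrib)
      qed
      ultimately have "t > 0 \<Longrightarrow> a \<bullet> h \<le> (N (x + t *\<^sub>R h) - N x) / t \<and> (N (x + t *\<^sub>R h) - N x) / t \<le> g t \<bullet> h"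
        "t < 0 \<Longrightarrow> g t \<bullet> h \<le> (N (x + t *\<^sub>R h) - N x) / t \<and> (N (x + t *\<^sub>R h) - N x) / t \<le> a \<bullet> h"
        by (simp_all add: field_simps)
      with that show ?thesis by linarith
    qed
    have "((\<lambda>t. g t \<bullet> h) \<longlongrightarrow> a \<bullet> h) (at 0)"
    proof (rule ccontr)
      assume "\<not> ?thesis"
      then obtain e where e: "e > 0" "\<not> (\<forall>\<^sub>F t in at 0. dist (g t \<bullet> h) (a \<bullet> h) < e)"
        unfolding tendsto_iff by blast
      have "\<exists>t. \<bar>t\<bar> < inverse (real (Suc n)) \<and> dist (g t \<bullet> h) (a \<bullet> h) \<ge> e" for n
      proof (rule ccontr)
        assume "\<not> ?thesis"
        then have "\<forall>\<^sub>F t in at 0. dist (g t \<bullet> h) (a \<bullet> h) < e"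
          unfolding eventually_at by (intro exI[of _ "inverse (real (Suc n))"]) (auto simp: not_le)
        with e(2) show False by blast
      qed
      then obtain t where t: "\<And>n. \<bar>t n\<bar> < inverse (real (Suc n))"
          "\<And>n. dist (g (t n) \<bullet> h) (a \<bullet> h) \<ge> e"
        by metis
      have t0: "t \<longlonglongrightarrow> 0"
        by (rule Lim_null_comparison[OF _ LIMSEQ_inverse_real_of_nat])
          (use t(1) in \<open>auto intro!: always_eventually less_imp_le\<close>)
      obtain b r where b: "b \<in> dual_ball N" "strict_mono r" "((g \<circ> t) \<circ> r) \<longlonglongrightarrow> b"
        using compact_dual_ball[OF N, unfolded compact_def, rule_format, of "g \<circ> t"] g(1) by auto
      have tr: "(\<lambda>n. t (r n)) \<longlonglongrightarrow> 0"
        using LIMSEQ_subseq_LIMSEQ[OF t0 b(2)] by (simp add: o_def)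
      have gr: "(\<lambda>n. g (t (r n))) \<longlonglongrightarrow> b" using b(3) by (simp add: o_def)
      have xr: "(\<lambda>n. x + t (r n) *\<^sub>R h) \<longlonglongrightarrow> x"
        using tendsto_add[OF tendsto_const tendsto_scaleR[OF tr tendsto_const], of x h] by simp
      have "(\<lambda>n. N (x + t (r n) *\<^sub>R h)) \<longlonglongrightarrow> b \<bullet> x"
        using tendsto_inner[OF gr xr] by (simp add: g(2))
      then have "b \<bullet> x = N x"
        using tendsto_is_norm[OF N xr] LIMSEQ_unique by blast
      then have "b \<bullet> h = a \<bullet> h"
        using smooth_at_functional_unique[OF N smooth X] b(1) a h by blast
      then have "(\<lambda>n. dist (g (t (r n)) \<bullet> h) (a \<bullet> h)) \<longlonglongrightarrow> 0"
        using tendsto_dist[OF tendsto_inner[OF gr tendsto_const] tendsto_const, of h "a \<bullet> h"] by simp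
      then have "e \<le> 0"
        by (rule LIMSEQ_le_const) (use t(2) in auto)
      then show False using e(1) by simp
    qed
    then have "((\<lambda>t. g t \<bullet> h - a \<bullet> h) \<longlongrightarrow> 0) (at 0)"
      by (simp add: LIM_zero)
    then have "((\<lambda>t. (N (x + t *\<^sub>R h) - N x) / t - a \<bullet> h) \<longlongrightarrow> 0) (at 0)"
      by (rule Lim_transform_bound[rotated])
        (use between in \<open>auto simp: eventually_at intro!: exI[of _ 1]\<close>)
    then show ?thesis by (simp add: LIM_zero_iff)
  qed
  then show ?thesis by blast
qed

section \<open>Counting the constraints of a framework\<close>

lemma has_vector_derivative_iff_quotient_tendsto:
  "(f has_vector_derivative d) (at (0::real)) \<longleftrightarrow> ((\<lambda>t. (1 / t) *\<^sub>R (f t - f 0)) \<longlongrightarrow> d) (at 0)"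
proof -
  have eq: "norm ((1 / norm t) *\<^sub>R (f t - (f 0 + t *\<^sub>R d))) = norm ((1 / t) *\<^sub>R (f t - f 0) - d)"
    if "t \<noteq> 0" for t
  proof -
    have "(1 / t) *\<^sub>R (f t - f 0) - d = (1 / t) *\<^sub>R (f t - (f 0 + t *\<^sub>R d))"
      using that by (simp add: scaleR_diff_right scaleR_add_right)
    then show ?thesis by simp
  qed
  have "(f has_vector_derivative d) (at 0) \<longleftrightarrow>
      ((\<lambda>t. norm ((1 / norm t) *\<^sub>R (f t - (f 0 + t *\<^sub>R d)))) \<longlongrightarrow> 0) (at 0)"
    unfolding has_vector_derivative_def has_derivative_at2 tendsto_norm_zero_iff
    by (simp add: bounded_linear_scaleR_left)
  also have "\<dots> \<longleftrightarrow> ((\<lambda>t. norm ((1 / t) *\<^sub>R (f t - f 0) - d)) \<longlongrightarrow> 0) (at 0)"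
    by (rule LIM_cong[OF refl eq refl])
  also have "\<dots> \<longleftrightarrow> ((\<lambda>t. (1 / t) *\<^sub>R (f t - f 0)) \<longlongrightarrow> d) (at 0)"
    unfolding tendsto_norm_zero_iff by (rule LIM_zero_iff)
  finally show ?thesis .
qed

text \<open>
  A single linear functional lowers the dimension of a subspace by at most one, and by exactly one
  if it does not vanish there. The second part applies to functionals none of which follows from
  the others: a vector killed by all functionals but one shows that each of them is nonzero on the
  common kernel of any collection of the others.
\<close>
lemma dim_common_kernel:
  fixes r :: "'e \<Rightarrow> 'a::real_vector \<Rightarrow> real"
  assumes "finite F" "subspace W" "finite_dim W" "\<And>e. e \<in> F \<Longrightarrow> linear (r e)"
  shows "dim W \<le> dim {z\<in>W. \<forall>e\<in>F. r e z = 0} + card F"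
    and "(\<And>e. e \<in> F \<Longrightarrow> \<exists>z\<in>W. (\<forall>d\<in>F - {e}. r d z = 0) \<and> r e z \<noteq> 0) \<Longrightarrow>
      dim W = dim {z\<in>W. \<forall>e\<in>F. r e z = 0} + card F"
proof -
  have "dim W \<le> dim {z\<in>W. \<forall>e\<in>F. r e z = 0} + card F \<and>
      ((\<forall>e\<in>F. \<exists>z\<in>W. (\<forall>d\<in>F - {e}. r d z = 0) \<and> r e z \<noteq> 0) \<longrightarrow>
        dim W = dim {z\<in>W. \<forall>e\<in>F. r e z = 0} + card F)"
    using assms(1,4)
  proof (induction F)
    case (insert e F)
    define K where "K = {z\<in>W. \<forall>d\<in>F. r d z = 0}"
    have lin: "linear (r e)" and linF: "\<And>d. d \<in> F \<Longrightarrow> linear (r d)"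
      using insert.prems by auto
    have K: "subspace K" "finite_dim K"
      using assms(2,3) finite_dim_subset[of W K] linF
      unfolding K_def subspace_def
      by (auto simp: linear_0 linear_add linear_scale)
    have rn: "dim K = dim {z\<in>K. r e z = 0} + dim (r e ` K)"
      by (rule rank_nullity[OF lin K])
    have ker: "{z\<in>K. r e z = 0} = {z\<in>W. \<forall>d\<in>insert e F. r d z = 0}"
      unfolding K_def by auto
    have le1: "dim (r e ` K) \<le> 1"
      using dim_subset_UNIV[of "r e ` K"] by simp
    have *: "dim W \<le> dim K + card F \<and>
        ((\<forall>e\<in>F. \<exists>z\<in>W. (\<forall>d\<in>F - {e}. r d z = 0) \<and> r e z \<noteq> 0) \<longrightarrow>
          dim W = dim K + card F)"
      unfolding K_def by (rule insert.IH) (rule linF)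
    note IH = conjunct1[OF *] mp[OF conjunct2[OF *]]
    have "dim W = dim {z\<in>W. \<forall>d\<in>insert e F. r d z = 0} + card (insert e F)"
      if ind: "\<forall>e'\<in>insert e F. \<exists>z\<in>W. (\<forall>d\<in>insert e F - {e'}. r d z = 0) \<and> r e' z \<noteq> 0"
    proof -
      have "\<forall>e'\<in>F. \<exists>z\<in>W. (\<forall>d\<in>F - {e'}. r d z = 0) \<and> r e' z \<noteq> 0"
      proof
        fix e' assume "e' \<in> F"
        then obtain z where "z \<in> W" "\<forall>d\<in>insert e F - {e'}. r d z = 0" "r e' z \<noteq> 0"
          using ind by blast
        then show "\<exists>z\<in>W. (\<forall>d\<in>F - {e'}. r d z = 0) \<and> r e' z \<noteq> 0"
          by (intro bexI[of _ z]) auto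
      qed
      then have "dim W = dim K + card F" by (rule IH(2))
      moreover obtain z where "z \<in> W" "\<forall>d\<in>insert e F - {e}. r d z = 0" "r e z \<noteq> 0"
        using ind by blast
      then have "z \<in> K" "r e z \<noteq> 0"
        using insert.hyps(2) unfolding K_def by auto
      then have "\<not> r e ` K \<subseteq> {0}" by blast
      then have "dim (r e ` K) \<noteq> 0" by simp
      then have "dim (r e ` K) = 1" using le1 by linarith
      ultimately show ?thesis
        using rn insert.hyps by (simp add: ker)
    qed
    moreover have "dim W \<le> dim {z\<in>W. \<forall>d\<in>insert e F. r d z = 0} + card (insert e F)"
      using IH(1) rn le1 insert.hyps unfolding ker by simp
    ultimately show ?case by blast
  qed simp
  then show "dim W \<le> dim {z\<in>W. \<forall>e\<in>F. r e z = 0} + card F"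
    and "(\<And>e. e \<in> F \<Longrightarrow> \<exists>z\<in>W. (\<forall>d\<in>F - {e}. r d z = 0) \<and> r e z \<noteq> 0) \<Longrightarrow>
      dim W = dim {z\<in>W. \<forall>e\<in>F. r e z = 0} + card F"
    by blast+
qed

text \<open>
  An edge is an unordered pair, so the functional is obtained from one of the two orders of its
  ends; the condition in the definition of a flex is symmetric because the norm is even.
\<close>
lemma edge_rate:
  fixes N :: "'a::euclidean_space \<Rightarrow> real"
  assumes "is_norm N" "subspace X" "well_positioned X N E p" "e \<in> E" "card e = 2"
  shows "\<exists>r :: ('v \<Rightarrow> 'a) \<Rightarrow> real. linear r \<and>
    (\<forall>z z'. (\<forall>v\<in>e. z v = z' v) \<longrightarrow> r z = r z') \<and>
    (\<forall>z. z ` e \<subseteq> X \<longrightarrow> (r z = 0 \<longleftrightarrow>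
      (\<forall>v w. {v, w} = e \<longrightarrow>
        ((\<lambda>t. (N ((p v + t *\<^sub>R z v) - (p w + t *\<^sub>R z w)) - N (p v - p w)) / t) \<longlongrightarrow> 0) (at 0))))"
proof -
  obtain v w where vw: "e = {v, w}" "v \<noteq> w"
    using assms(5) by (metis card_2_iff)
  then have smooth: "smooth_at X N (p v - p w)"
    using assms(3,4) unfolding well_positioned_def by blast
  obtain a where a: "\<And>h. h \<in> X \<Longrightarrow>
      ((\<lambda>t. (N ((p v - p w) + t *\<^sub>R h) - N (p v - p w)) / t) \<longlongrightarrow> a \<bullet> h) (at 0)"
    using smooth_at_gateaux[OF assms(1) smooth assms(2)] by blast
  define Q where "Q z x y t = (N ((p x + t *\<^sub>R z x) - (p y + t *\<^sub>R z y)) - N (p x - p y)) / t" for z x y t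
  have sym: "Q z x y = Q z y x" for z x y
    unfolding Q_def using is_normD(7)[OF assms(1)] by (metis (no_types, lifting))
  have Q: "(Q z v w \<longlongrightarrow> a \<bullet> (z v - z w)) (at 0)" if "z ` e \<subseteq> X" for z
  proof -
    have "z v - z w \<in> X"
      using that vw(1) assms(2) by (auto intro: subspace_diff)
    from a[OF this] show ?thesis
      unfolding Q_def by (simp add: algebra_simps)
  qed
  show ?thesis
  proof (intro exI[of _ "\<lambda>z. a \<bullet> (z v - z w)"] conjI allI impI)
    show "linear (\<lambda>z :: 'v \<Rightarrow> 'a. a \<bullet> (z v - z w))"
      by (intro linearI) (simp_all add: inner_simps algebra_simps)
    fix z :: "'v \<Rightarrow> 'a" assume z: "z ` e \<subseteq> X"
    have "(\<forall>x y. {x, y} = e \<longrightarrow> (Q z x y \<longlongrightarrow> 0) (at 0)) \<longleftrightarrow> (Q z v w \<longlongrightarrow> 0) (at 0)"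
      using sym[of z v w] vw(1) by (metis doubleton_eq_iff)
    also have "\<dots> \<longleftrightarrow> a \<bullet> (z v - z w) = 0"
      using Q[OF z] LIM_unique by metis
    finally show "a \<bullet> (z v - z w) = 0 \<longleftrightarrow> (\<forall>x y. {x, y} = e \<longrightarrow>
        ((\<lambda>t. (N ((p x + t *\<^sub>R z x) - (p y + t *\<^sub>R z y)) - N (p x - p y)) / t) \<longlongrightarrow> 0) (at 0))"
      unfolding Q_def by blast
  qed (use vw in auto)
qed

lemma rigid_velocity_infinitesimal_flex:
  fixes N :: "'a::euclidean_space \<Rightarrow> real"
  assumes N: "is_norm N" and "\<eta> \<in> rigid_velocities X N" "x \<in> X" "y \<in> X"
  shows "((\<lambda>t. (N ((x + t *\<^sub>R \<eta> x) - (y + t *\<^sub>R \<eta> y)) - N (x - y)) / t) \<longlongrightarrow> 0) (at 0)"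
proof -
  obtain \<alpha> where \<alpha>: "rigid_motion X N \<alpha>" and \<eta>: "\<eta> = (\<lambda>x\<in>X. vector_derivative (\<alpha> x) (at 0))"
    using assms(2) unfolding rigid_velocities_def by blast
  define d where "d z t = (1 / t) *\<^sub>R (\<alpha> z t - z) - \<eta> z" for z t
  have d0: "(d z \<longlongrightarrow> 0) (at 0)" if z: "z \<in> X" for z
  proof -
    have "(\<alpha> z has_vector_derivative \<eta> z) (at 0)" "\<alpha> z 0 = z"
      using \<alpha> z unfolding rigid_motion_def \<eta> by (auto simp: vector_derivative_works[symmetric])
    then show ?thesis
      unfolding d_def has_vector_derivative_iff_quotient_tendsto by (simp add: LIM_zero)
  qed
  have bound: "\<bar>(N ((x + t *\<^sub>R \<eta> x) - (y + t *\<^sub>R \<eta> y)) - N (x - y)) / t\<bar> \<le> N (d x t - d y t)"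
    if t: "t \<noteq> 0" "\<bar>t\<bar> \<le> 1" for t
  proof -
    have "N (\<alpha> x t - \<alpha> y t) = N (x - y)"
      using \<alpha> assms(3,4) t(2) unfolding rigid_motion_def by (auto simp: abs_le_iff)
    then have "\<bar>N ((x + t *\<^sub>R \<eta> x) - (y + t *\<^sub>R \<eta> y)) - N (x - y)\<bar>
        \<le> N ((\<alpha> x t - \<alpha> y t) - ((x + t *\<^sub>R \<eta> x) - (y + t *\<^sub>R \<eta> y)))"
      using is_normD(7,8)[OF N, of "\<alpha> x t - \<alpha> y t" "(x + t *\<^sub>R \<eta> x) - (y + t *\<^sub>R \<eta> y)"]
        is_normD(8)[OF N, of "(x + t *\<^sub>R \<eta> x) - (y + t *\<^sub>R \<eta> y)" "\<alpha> x t - \<alpha> y t"] by linarith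
    also have "(\<alpha> x t - \<alpha> y t) - ((x + t *\<^sub>R \<eta> x) - (y + t *\<^sub>R \<eta> y)) = t *\<^sub>R (d x t - d y t)"
      unfolding d_def using t(1) by (simp add: scaleR_right_diff_distrib)
    finally have "\<bar>N ((x + t *\<^sub>R \<eta> x) - (y + t *\<^sub>R \<eta> y)) - N (x - y)\<bar> \<le> \<bar>t\<bar> * N (d x t - d y t)"
      by (simp only: is_normD(3)[OF N])
    then show ?thesis
      using t(1) by (simp add: abs_divide field_simps)
  qed
  have "((\<lambda>t. N (d x t - d y t)) \<longlongrightarrow> 0) (at 0)"
    using tendsto_is_norm[OF N tendsto_diff[OF d0[OF assms(3)] d0[OF assms(4)]]]
    by (simp add: is_normD(5)[OF N])
  then show ?thesis
    by (rule Lim_null_comparison[rotated])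
      (use bound in \<open>auto simp: eventually_at intro!: exI[of _ 1]\<close>)
qed

text \<open>
  The counting argument uses only that rigid motions have velocities which depend linearly and
  injectively on parameters in some finite-dimensional space \<open>P\<close>; its dimension plays the role of
  \<open>l\<close>.
\<close>
locale parametrised_rigid_velocities =
  fixes X :: "'a::euclidean_space set" and N :: "'a \<Rightarrow> real"
    and P :: "'q::euclidean_space set" and F :: "'q \<Rightarrow> 'a \<Rightarrow> 'a"
  assumes X: "subspace X" and N: "is_norm N" and P: "subspace P"
    and lin: "\<And>x. linear (\<lambda>q. F q x)"
    and velocities: "rigid_velocities X N = (\<lambda>q. \<lambda>x\<in>X. F q x) ` P"
    and maps: "\<And>q x. q \<in> P \<Longrightarrow> x \<in> X \<Longrightarrow> F q x \<in> X"
    and inj: "\<And>q. q \<in> P \<Longrightarrow> (\<And>x. x \<in> X \<Longrightarrow> F q x = 0) \<Longrightarrow> q = 0"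
begin

text \<open>
  Flexes are prescribed only on \<open>V\<close>. Setting them to 0 elsewhere makes equality on \<open>V\<close> an equality of
  functions.
\<close>
definition trivial_flexes :: "'v set \<Rightarrow> ('v \<Rightarrow> 'a) \<Rightarrow> ('v \<Rightarrow> 'a) set"
  where "trivial_flexes V p = {z \<in> functions_on V X. trivial_flex X N V p z}"

lemma trivial_flexes_eq:
  assumes "p ` V \<subseteq> X"
  shows "trivial_flexes V p = (\<lambda>q v. if v \<in> V then F q (p v) else 0) ` P"
proof (intro equalityI subsetI)
  fix z assume "z \<in> trivial_flexes V p"
  then have z: "z \<in> functions_on V X" "trivial_flex X N V p z"
    unfolding trivial_flexes_def by auto
  then obtain q where "q \<in> P" "\<forall>v\<in>V. z v = (\<lambda>x\<in>X. F q x) (p v)"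
    unfolding trivial_flex_def velocities by blast
  with z(1) assms show "z \<in> (\<lambda>q v. if v \<in> V then F q (p v) else 0) ` P"
    unfolding functions_on_def by (intro image_eqI[of _ _ q]) (auto simp: fun_eq_iff image_subset_iff)
next
  fix z assume "z \<in> (\<lambda>q v. if v \<in> V then F q (p v) else 0) ` P"
  then obtain q where q: "q \<in> P" and z: "z = (\<lambda>v. if v \<in> V then F q (p v) else 0)" by blast
  have q': "(\<lambda>x\<in>X. F q x) \<in> rigid_velocities X N"
    using q velocities by blast
  then show "z \<in> trivial_flexes V p"
    using q' q z assms maps unfolding trivial_flexes_def functions_on_def trivial_flex_def
    by (auto intro!: bexI[of _ "\<lambda>x\<in>X. F q x"])
qed

text \<open>
  Fullness says that a velocity is determined by its values at the vertices, so evaluation at the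
  vertices is injective on the parameters.
\<close>
lemma
  assumes "full_framework X N V p"
  shows subspace_trivial_flexes: "subspace (trivial_flexes V p)"
    and dim_trivial_flexes: "dim (trivial_flexes V p) = dim P"
proof -
  have full: "p ` V \<subseteq> X" "inj_on (\<lambda>\<eta>. restrict \<eta> (p ` V)) (rigid_velocities X N)"
    using assms unfolding full_framework_def full_set_def by auto
  define \<Phi> where "\<Phi> q = (\<lambda>v. if v \<in> V then F q (p v) else 0)" for q
  have \<Phi>: "linear \<Phi>"
    unfolding \<Phi>_def by (intro linearI) (auto simp: fun_eq_iff linear_add[OF lin] linear_scale[OF lin])
  have eq: "trivial_flexes V p = \<Phi> ` P"
    using trivial_flexes_eq[OF full(1)] unfolding \<Phi>_def .
  then show "subspace (trivial_flexes V p)"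
    using \<Phi> P by (simp add: linear_subspace_image)
  have "q = 0" if q: "q \<in> P" "\<Phi> q = 0" for q
  proof (rule inj[OF q(1)])
    fix x assume x: "x \<in> X"
    have "F q (p v) = F 0 (p v)" if "v \<in> V" for v
      using fun_cong[OF q(2), of v] that linear_0[OF lin] unfolding \<Phi>_def by simp
    then have "restrict (\<lambda>x\<in>X. F q x) (p ` V) = restrict (\<lambda>x\<in>X. F 0 x) (p ` V)"
      using full(1) by (auto simp: restrict_def fun_eq_iff)
    moreover have "(\<lambda>x\<in>X. F q x) \<in> rigid_velocities X N" "(\<lambda>x\<in>X. F 0 x) \<in> rigid_velocities X N"
      using q(1) subspace_0[OF P] velocities by blast+
    ultimately have "(\<lambda>x\<in>X. F q x) = (\<lambda>x\<in>X. F 0 x)"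
      by (rule inj_onD[OF full(2)])
    then show "F q x = 0"
      using x linear_0[OF lin] by (metis restrict_apply')
  qed
  then show "dim (trivial_flexes V p) = dim P"
    unfolding eq by (intro dim_linear_image_inj[OF \<Phi> P]) auto
qed

lemma trivial_flex_is_flex:
  assumes "finite_simple_graph V E" "p ` V \<subseteq> X" "trivial_flex X N V p z"
  shows "infinitesimal_flex X N V E p z"
proof -
  obtain \<eta> where \<eta>: "\<eta> \<in> rigid_velocities X N" "\<forall>v\<in>V. z v = \<eta> (p v)"
    using assms(3) unfolding trivial_flex_def by blast
  obtain q where q: "q \<in> P" "\<eta> = (\<lambda>x\<in>X. F q x)"
    using \<eta>(1) velocities by blast
  show ?thesis
    unfolding infinitesimal_flex_def
  proof (intro conjI allI impI)
    show "z ` V \<subseteq> X"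
      using \<eta>(2) q assms(2) maps by auto
    fix v w assume "{v, w} \<in> E"
    then have "v \<in> V" "w \<in> V"
      using assms(1) unfolding finite_simple_graph_def by auto
    then show "((\<lambda>t. (N ((p v + t *\<^sub>R z v) - (p w + t *\<^sub>R z w)) - N (p v - p w)) / t) \<longlongrightarrow> 0) (at 0)"
      using rigid_velocity_infinitesimal_flex[OF N \<eta>(1), of "p v" "p w"] assms(2) \<eta>(2) by auto
  qed
qed

lemma infinitesimal_flex_cong:
  assumes "finite_simple_graph V E" "\<forall>v\<in>V. z v = z' v"
  shows "infinitesimal_flex X N V E p z \<longleftrightarrow> infinitesimal_flex X N V E p z'"
proof -
  define Q where "Q y v w \<longleftrightarrow>
    ((\<lambda>t. (N ((p v + t *\<^sub>R y v) - (p w + t *\<^sub>R y w)) - N (p v - p w)) / t) \<longlongrightarrow> 0) (at 0)" for y v w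
  have "Q z v w = Q z' v w" if "{v, w} \<in> E" for v w
  proof -
    have "v \<in> V" "w \<in> V"
      using that assms(1) unfolding finite_simple_graph_def by auto
    then show ?thesis using assms(2) unfolding Q_def by simp
  qed
  moreover have "z ` V = z' ` V"
    using assms(2) by auto
  ultimately show ?thesis
    unfolding infinitesimal_flex_def Q_def[symmetric] by blast
qed

text \<open>
  The space \<open>K U F\<close> consists of the placements of \<open>U\<close> that satisfy the conditions of the edges in
  \<open>F\<close>. Rigidity turns \<open>K V E\<close> into the space of trivial flexes. Minimality provides, for every edge, a
  placement violating only the condition of that edge. Such a placement can be restricted to the
  vertices of a subgraph, so the conditions of the edges of a subgraph are independent already on
  the placements of its own vertices.
\<close>
theorem rigidity_counts:
  fixes V :: "'v set"
  assumes G: "finite_simple_graph V E" and fw: "framework X V E p"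
    and full: "full_framework X N V p" and wp: "well_positioned X N E p"
  shows "infinitesimally_rigid X N V E p \<Longrightarrow>
      int (card E) \<ge> int (dim X) * int (card V) - int (dim P)" (is "?rigid \<Longrightarrow> ?ge")
    and "minimally_infinitesimally_rigid X N V E p \<Longrightarrow>
      int (card E) = int (dim X) * int (card V) - int (dim P)" (is "?minimal \<Longrightarrow> ?eq")
    and "\<lbrakk>minimally_infinitesimally_rigid X N V E p; is_subgraph VH EH V E;
        full_framework X N VH (restrict p VH)\<rbrakk> \<Longrightarrow>
      int (card EH) \<le> int (dim X) * int (card VH) - int (dim P)"
proof -
  have finV: "finite V" and E: "\<And>e. e \<in> E \<Longrightarrow> e \<subseteq> V" "\<And>e. e \<in> E \<Longrightarrow> card e = 2"
    using G unfolding finite_simple_graph_def by auto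
  have finE: "finite E"
    using finV E(1) by (meson Pow_iff finite_Pow_iff finite_subset subsetI)
  have pX: "p ` V \<subseteq> X" using fw unfolding framework_def by blast
  define rates where "rates e r \<longleftrightarrow> linear r \<and>
    (\<forall>z z'. (\<forall>v\<in>e. z v = z' v) \<longrightarrow> r z = r z') \<and>
    (\<forall>z. z ` e \<subseteq> X \<longrightarrow> (r z = 0 \<longleftrightarrow>
      (\<forall>v w. {v, w} = e \<longrightarrow>
        ((\<lambda>t. (N ((p v + t *\<^sub>R z v) - (p w + t *\<^sub>R z w)) - N (p v - p w)) / t) \<longlongrightarrow> 0) (at 0))))"
    for e :: "'v set" and r :: "('v \<Rightarrow> 'a) \<Rightarrow> real"
  have "\<forall>e\<in>E. \<exists>r. rates e r"
    using edge_rate[OF N X wp _ E(2)] unfolding rates_def by blast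
  then obtain r where "\<forall>e\<in>E. rates e (r e)"
    by metis
  then have lin_r: "\<And>e. e \<in> E \<Longrightarrow> linear (r e)"
    and cong_r: "\<And>e z z'. e \<in> E \<Longrightarrow> (\<And>v. v \<in> e \<Longrightarrow> z v = z' v) \<Longrightarrow> r e z = r e z'"
    and r: "\<And>e z. e \<in> E \<Longrightarrow> z ` e \<subseteq> X \<Longrightarrow> r e z = 0 \<longleftrightarrow>
      (\<forall>v w. {v, w} = e \<longrightarrow>
        ((\<lambda>t. (N ((p v + t *\<^sub>R z v) - (p w + t *\<^sub>R z w)) - N (p v - p w)) / t) \<longlongrightarrow> 0) (at 0))"
    unfolding rates_def by blast+
  have flex_iff: "infinitesimal_flex X N U F p z \<longleftrightarrow> (\<forall>e\<in>F. r e z = 0)"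
    if "F \<subseteq> E" "\<And>e. e \<in> F \<Longrightarrow> e \<subseteq> U" "z ` U \<subseteq> X" for U F z
  proof -
    have "r e z = 0 \<longleftrightarrow> (\<forall>v w. {v, w} = e \<longrightarrow>
        ((\<lambda>t. (N ((p v + t *\<^sub>R z v) - (p w + t *\<^sub>R z w)) - N (p v - p w)) / t) \<longlongrightarrow> 0) (at 0))"
      if "e \<in> F" for e
      using r[of e z] that \<open>F \<subseteq> E\<close> \<open>z ` U \<subseteq> X\<close> \<open>\<And>e. e \<in> F \<Longrightarrow> e \<subseteq> U\<close>[OF that] by blast
    then show ?thesis
      using \<open>z ` U \<subseteq> X\<close> unfolding infinitesimal_flex_def by auto
  qed
  define K where "K U F = {z\<in>functions_on U X. \<forall>e\<in>F. r e z = 0}" for U F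
  have W: "subspace (functions_on U X)" for U :: "'v set"
    using subspace_functions_on[OF X] .
  have dimW: "finite_dim (functions_on U X)" "dim (functions_on U X) = card U * dim X"
    if "finite U" for U :: "'v set"
    using dim_functions_on[OF that X] by auto
  have K_finite: "finite_dim (K U F)" if "finite U" for U F
    by (rule finite_dim_subset[OF dimW(1)[OF that]]) (auto simp: K_def)
  have triv_K: "trivial_flexes U p \<subseteq> K U F"
    if "F \<subseteq> E" "\<And>e. e \<in> F \<Longrightarrow> e \<subseteq> U" "finite U" "U \<subseteq> V" for U F
  proof
    fix z assume z: "z \<in> trivial_flexes U p"
    then have zU: "z ` U \<subseteq> X" "z \<in> functions_on U X" "trivial_flex X N U p z"
      unfolding trivial_flexes_def functions_on_def by auto
    have "finite_simple_graph U F"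
      using that E(2) unfolding finite_simple_graph_def by auto
    moreover have "p ` U \<subseteq> X"
      using pX that(4) by auto
    ultimately have "infinitesimal_flex X N U F p z"
      using trivial_flex_is_flex zU(3) by blast
    then show "z \<in> K U F"
      using flex_iff[OF that(1,2) zU(1)] zU(2) unfolding K_def by auto
  qed
  have dimT: "dim (trivial_flexes V p) = dim P"
    using dim_trivial_flexes[OF full] .
  have K_triv: "K V E = trivial_flexes V p" if ?rigid
  proof
    show "K V E \<subseteq> trivial_flexes V p"
    proof
      fix z assume z: "z \<in> K V E"
      then have "z ` V \<subseteq> X" "z \<in> functions_on V X"
        unfolding K_def functions_on_def by auto
      moreover have "infinitesimal_flex X N V E p z"
        using flex_iff[OF subset_refl E(1) \<open>z ` V \<subseteq> X\<close>] z unfolding K_def by auto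
      ultimately show "z \<in> trivial_flexes V p"
        using that unfolding infinitesimally_rigid_def trivial_flexes_def by blast
    qed
  qed (use triv_K[of E V] E(1) finV in auto)
  have bound: "card U * dim X \<le> dim (K U F) + card F" if "F \<subseteq> E" "finite U" for U F
  proof -
    have "finite F" "\<And>e. e \<in> F \<Longrightarrow> linear (r e)"
      using that finE lin_r finite_subset by auto
    from dim_common_kernel(1)[OF this(1) W dimW(1)[OF that(2)] this(2)] show ?thesis
      unfolding K_def dimW(2)[OF that(2)] by simp
  qed
  show ?ge if ?rigid
    using bound[of E V] K_triv[OF that] dimT finV
    by (simp add: algebra_simps flip: of_nat_mult of_nat_add)
  assume minimal: ?minimal
  then have rigid: ?rigid
    unfolding minimally_infinitesimally_rigid_def by blast
  have witness: "\<exists>z\<in>functions_on V X. (\<forall>d\<in>E - {e}. r d z = 0) \<and> r e z \<noteq> 0" if e: "e \<in> E" for e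
  proof -
    have "\<not> infinitesimally_rigid X N V (E - {e}) p"
      using minimal e unfolding minimally_infinitesimally_rigid_def by blast
    then obtain z0 where z0: "infinitesimal_flex X N V (E - {e}) p z0" "\<not> trivial_flex X N V p z0"
      unfolding infinitesimally_rigid_def by blast
    define z where "z = (\<lambda>v. if v \<in> V then z0 v else 0)"
    have "finite_simple_graph V (E - {e})"
      using G unfolding finite_simple_graph_def by blast
    then have flex: "infinitesimal_flex X N V (E - {e}) p z"
      using infinitesimal_flex_cong[of V "E - {e}" z z0 p] z0(1) unfolding z_def by simp
    then have zX: "z ` V \<subseteq> X" unfolding infinitesimal_flex_def by blast
    have zW: "z \<in> functions_on V X"
      using zX unfolding functions_on_def z_def by auto
    have 0: "\<forall>d\<in>E - {e}. r d z = 0"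
      using flex flex_iff[of "E - {e}" V z] zX E(1) by blast
    have "z \<notin> trivial_flexes V p"
      using z0(2) unfolding trivial_flexes_def trivial_flex_def z_def by auto
    then have "r e z \<noteq> 0"
      using K_triv[OF rigid] 0 zW unfolding K_def by blast
    with 0 zW show ?thesis by blast
  qed
  have exact: "card U * dim X = dim (K U F) + card F"
    if F: "F \<subseteq> E" "\<And>e. e \<in> F \<Longrightarrow> e \<subseteq> U" "finite U" "U \<subseteq> V" for U F
  proof -
    have "\<exists>z\<in>functions_on U X. (\<forall>d\<in>F - {e}. r d z = 0) \<and> r e z \<noteq> 0" if e: "e \<in> F" for e
    proof -
      obtain z where z: "z \<in> functions_on V X" "\<forall>d\<in>E - {e}. r d z = 0" "r e z \<noteq> 0"
        using witness e F(1) by blast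
      \<comment> \<open>the ends of the edges in \<open>F\<close> lie in \<open>U\<close>, so their rates do not change\<close>
      define y where "y = (\<lambda>v. if v \<in> U then z v else 0)"
      have "r d y = r d z" if "d \<in> F" for d
        using F(1) F(2)[OF that] that by (intro cong_r) (auto simp: y_def)
      moreover have "y \<in> functions_on U X"
        using z(1) F(4) unfolding functions_on_def y_def by auto
      ultimately show ?thesis
        using z e F(1) by (intro bexI[of _ y]) auto
    qed
    moreover have "finite F" "\<And>e. e \<in> F \<Longrightarrow> linear (r e)"
      using F finE lin_r finite_subset by auto
    ultimately have "dim (functions_on U X) =
        dim {z\<in>functions_on U X. \<forall>e\<in>F. r e z = 0} + card F"
      by (intro dim_common_kernel(2)[OF _ W dimW(1)[OF F(3)]])
    then show ?thesis
      unfolding K_def dimW(2)[OF F(3)] .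
  qed
  show ?eq
    using exact[of E V] E(1) finV K_triv[OF rigid] dimT
    by (simp add: algebra_simps flip: of_nat_mult of_nat_add)
  assume H: "is_subgraph VH EH V E" and fullH: "full_framework X N VH (restrict p VH)"
  have H': "EH \<subseteq> E" "VH \<subseteq> V" "\<And>e. e \<in> EH \<Longrightarrow> e \<subseteq> VH" "finite VH"
    using H unfolding is_subgraph_def finite_simple_graph_def by auto
  have "full_framework X N VH p"
    using fullH unfolding full_framework_def by simp
  then have "dim P = dim (trivial_flexes VH p)"
    using dim_trivial_flexes by metis
  also have "\<dots> \<le> dim (K VH EH)"
    by (intro dim_mono_finite triv_K K_finite H')
  finally show "int (card EH) \<le> int (dim X) * int (card VH) - int (dim P)"
    using exact[OF H'(1,3,4,2)]
    by (simp add: algebra_simps flip: of_nat_mult of_nat_add)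
qed

end

section \<open>Isometries of finite-dimensional normed spaces\<close>

text \<open>
  The isometries form a group under composition, which the reflection argument below uses; the
  subspace \<open>X\<close> is kept explicit because the maps of interest are defined only there.
\<close>
definition surjective_isometry :: "'a::real_vector set \<Rightarrow> ('a \<Rightarrow> real) \<Rightarrow> ('a \<Rightarrow> 'a) \<Rightarrow> bool"
  where "surjective_isometry X N g \<longleftrightarrow>
    bij_betw g X X \<and> (\<forall>x\<in>X. \<forall>y\<in>X. N (g x - g y) = N (x - y))"

lemma surjective_isometry_comp:
  assumes "surjective_isometry X N f" "surjective_isometry X N g"
  shows "surjective_isometry X N (\<lambda>x. f (g x))"
proof -
  have "bij_betw (f \<circ> g) X X"
    using assms bij_betw_trans unfolding surjective_isometry_def by blast
  moreover have "g x \<in> X" if "x \<in> X" for x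
    using assms(2) that unfolding surjective_isometry_def by (auto dest: bij_betwE)
  ultimately show ?thesis
    using assms unfolding surjective_isometry_def by (simp add: o_def)
qed

lemma surjective_isometry_inverse:
  assumes "surjective_isometry X N g"
  shows "surjective_isometry X N (inv_into X g)"
proof -
  have g: "bij_betw g X X" "\<And>x y. x \<in> X \<Longrightarrow> y \<in> X \<Longrightarrow> N (g x - g y) = N (x - y)"
    using assms unfolding surjective_isometry_def by auto
  have "N (inv_into X g x - inv_into X g y) = N (x - y)" if "x \<in> X" "y \<in> X" for x y
    using g(2)[of "inv_into X g x" "inv_into X g y"] that bij_betw_inv_into_right[OF g(1)]
      bij_betwE[OF bij_betw_inv_into[OF g(1)]] by metis
  then show ?thesis
    using bij_betw_inv_into[OF g(1)] unfolding surjective_isometry_def by blast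
qed

lemma surjective_isometry_reflection:
  assumes "subspace X" "is_norm N" "z \<in> X"
  shows "surjective_isometry X N (\<lambda>x. 2 *\<^sub>R z - x)"
proof -
  have in_X: "2 *\<^sub>R z - x \<in> X" if "x \<in> X" for x
    using that assms by (simp add: subspace_diff subspace_scale)
  then have "bij_betw (\<lambda>x. 2 *\<^sub>R z - x) X X"
    by (intro bij_betwI[of _ _ _ "\<lambda>x. 2 *\<^sub>R z - x"]) auto
  moreover have "N ((2 *\<^sub>R z - x) - (2 *\<^sub>R z - y)) = N (x - y)" for x y
    using is_normD(7)[OF assms(2), of x y] by (simp add: algebra_simps)
  ultimately show ?thesis
    unfolding surjective_isometry_def by blast
qed

text \<open>
  Vaisala's argument. Let \<open>z\<close> be the midpoint and \<open>\<psi>\<close> the reflection in \<open>z\<close>, which exchanges \<open>a\<close> and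
  \<open>b\<close>. If \<open>g\<close> fixes \<open>a\<close> and \<open>b\<close>, then so does \<open>\<psi> g\<^sup>-\<^sup>1 \<psi> g\<close>, and it moves \<open>z\<close> twice as far as \<open>g\<close>. The
  displacements of \<open>z\<close> are bounded, so they are all 0.
\<close>
lemma isometry_fixes_midpoint:
  assumes X: "subspace X" and N: "is_norm N" and a: "a \<in> X" and b: "b \<in> X"
    and g: "surjective_isometry X N g" "g a = a" "g b = b"
  defines "z \<equiv> (1/2) *\<^sub>R (a + b)"
  shows "g z = z"
proof -
  have z: "z \<in> X"
    unfolding z_def using X a b by (simp add: subspace_add subspace_scale)
  define \<psi> where "\<psi> x = 2 *\<^sub>R z - x" for x
  have \<psi>: "surjective_isometry X N \<psi>" "\<psi> a = b" "\<psi> b = a"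
    using surjective_isometry_reflection[OF X N z] unfolding \<psi>_def z_def by auto
  define W where "W = {g. surjective_isometry X N g \<and> g a = a \<and> g b = b}"
  have bound: "N (g z - z) \<le> 2 * N (a - z)" if "g \<in> W" for g
  proof -
    have "N (g z - a) = N (z - a)"
      using that a z unfolding W_def surjective_isometry_def by force
    then show ?thesis
      using is_normD(4)[OF N, of "g z - a" "a - z"] is_normD(7)[OF N, of z a] by simp
  qed
  define m where "m = (SUP g\<in>W. N (g z - z))"
  have bdd: "bdd_above ((\<lambda>g. N (g z - z)) ` W)"
    using bound by (auto intro!: bdd_aboveI)
  have le: "N (g z - z) \<le> m" if "g \<in> W" for g
    unfolding m_def by (rule cSUP_upper[OF that bdd])
  have double: "2 * N (g z - z) \<le> m" if g: "g \<in> W" for g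
  proof -
    have iso: "surjective_isometry X N g" "g a = a" "g b = b"
      using g unfolding W_def by auto
    have bij: "bij_betw g X X" using iso(1) unfolding surjective_isometry_def by blast
    define h where "h x = \<psi> (inv_into X g (\<psi> (g x)))" for x
    have "inv_into X g a = a" "inv_into X g b = b"
      by (rule inv_into_f_eq[OF bij_betw_imp_inj_on[OF bij] a iso(2)],
          rule inv_into_f_eq[OF bij_betw_imp_inj_on[OF bij] b iso(3)])
    then have "h a = a" "h b = b"
      unfolding h_def by (simp_all add: iso(2,3) \<psi>(2,3))
    moreover have "surjective_isometry X N h"
      unfolding h_def
      by (intro surjective_isometry_comp[OF \<psi>(1)] iso(1)
          surjective_isometry_comp[OF surjective_isometry_inverse[OF iso(1)]])
    ultimately have "h \<in> W"
      unfolding W_def by blast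
    have gz: "g z \<in> X" using bij z by (auto dest: bij_betwE)
    then have \<psi>gz: "\<psi> (g z) \<in> X"
      using \<psi>(1) unfolding surjective_isometry_def by (auto dest: bij_betwE)
    define u where "u = inv_into X g (\<psi> (g z))"
    have u: "u \<in> X" "g u = \<psi> (g z)"
      unfolding u_def using bij_betw_inv_into_right[OF bij \<psi>gz]
        bij_betwE[OF bij_betw_inv_into[OF bij]] \<psi>gz by auto
    have "h z - z = z - u"
      unfolding h_def u_def[symmetric] by (simp add: \<psi>_def scaleR_2)
    then have "N (h z - z) = N (g z - g u)"
      using iso(1) z u(1) unfolding surjective_isometry_def by simp
    also have "g z - g u = 2 *\<^sub>R (g z - z)"
      unfolding u(2) \<psi>_def by (simp add: scaleR_2)
    finally show ?thesis
      using le[OF \<open>h \<in> W\<close>] by (simp add: is_normD(3)[OF N] del: scaleR_right_diff_distrib)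
  qed
  have gW: "g \<in> W" using g unfolding W_def by blast
  then have "W \<noteq> {}" by blast
  moreover have "N (g z - z) \<le> m / 2" if "g \<in> W" for g
    using double[OF that] by simp
  ultimately have "(SUP g\<in>W. N (g z - z)) \<le> m / 2"
    by (rule cSUP_least)
  then have "m \<le> m / 2"
    unfolding m_def[symmetric] .
  with le[OF gW] have "N (g z - z) \<le> 0" by linarith
  then show ?thesis
    using is_normD(1,2)[OF N] by (metis eq_iff_diff_eq_0 order_antisym)
qed

text \<open>
  Compose \<open>f\<close> with the reflections in the two midpoints and with the inverse of \<open>f\<close>: the result
  fixes \<open>a\<close> and \<open>b\<close>, hence their midpoint.
\<close>
lemma isometry_preserves_midpoint:
  assumes X: "subspace X" and N: "is_norm N" and a: "a \<in> X" and b: "b \<in> X"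
    and f: "surjective_isometry X N f"
  shows "f ((1/2) *\<^sub>R (a + b)) = (1/2) *\<^sub>R (f a + f b)"
proof -
  define z where "z = (1/2) *\<^sub>R (a + b)"
  define z' where "z' = (1/2) *\<^sub>R (f a + f b)"
  have bij: "bij_betw f X X" using f unfolding surjective_isometry_def by blast
  then have fab: "f a \<in> X" "f b \<in> X" using a b by (auto dest: bij_betwE)
  have z: "z \<in> X" "z' \<in> X"
    unfolding z_def z'_def using X a b fab by (simp_all add: subspace_add subspace_scale)
  define h where "h x = 2 *\<^sub>R z - inv_into X f (2 *\<^sub>R z' - f x)" for x
  have "surjective_isometry X N h"
    unfolding h_def
    by (intro surjective_isometry_comp[OF surjective_isometry_reflection[OF X N z(1)]]
        surjective_isometry_comp[OF surjective_isometry_inverse[OF f]]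
        surjective_isometry_comp[OF surjective_isometry_reflection[OF X N z(2)]] f)
  moreover have "h a = a" "h b = b"
    unfolding h_def z_def z'_def using bij_betw_inv_into_left[OF bij] a b by auto
  ultimately have "h z = z"
    using isometry_fixes_midpoint[OF X N a b] unfolding z_def by blast
  then have eq: "inv_into X f (2 *\<^sub>R z' - f z) = z"
    unfolding h_def by (simp add: scaleR_2 algebra_simps)
  have "2 *\<^sub>R z' - f z \<in> X"
    using z X bij by (auto dest: bij_betwE intro!: subspace_diff subspace_scale)
  from bij_betw_inv_into_right[OF bij this] have "f z = 2 *\<^sub>R z' - f z"
    unfolding eq .
  then have "2 *\<^sub>R f z = 2 *\<^sub>R z'"
    by (simp add: scaleR_2 algebra_simps)
  then have "f z = z'" by simp
  then show ?thesis
    unfolding z_def z'_def .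
qed

text \<open>
  Preserving midpoints and 0 gives additivity. For homogeneity, the defect \<open>h t = f (t x) - t f x\<close> is
  additive in \<open>t\<close>, vanishes at integers and is bounded on the unit interval, so all multiples of
  \<open>h c\<close> lie in a bounded set.
\<close>
lemma midpoint_preserving_isometry_linear:
  assumes X: "subspace X" and N: "is_norm N"
    and maps: "\<And>x. x \<in> X \<Longrightarrow> f x \<in> X" and f0: "f 0 = 0"
    and iso: "\<And>x y. x \<in> X \<Longrightarrow> y \<in> X \<Longrightarrow> N (f x - f y) = N (x - y)"
    and mid: "\<And>a b. a \<in> X \<Longrightarrow> b \<in> X \<Longrightarrow> f ((1/2) *\<^sub>R (a + b)) = (1/2) *\<^sub>R (f a + f b)"
  shows "real_linear_on X f"
proof -
  note X_simps = subspace_0[OF X] subspace_add[OF X] subspace_scale[OF X]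
  have half: "f ((1/2) *\<^sub>R x) = (1/2) *\<^sub>R f x" if "x \<in> X" for x
    using mid[OF that X_simps(1)] by (simp add: f0)
  have add: "f (x + y) = f x + f y" if "x \<in> X" "y \<in> X" for x y
    using mid[OF that] half[of "x + y"] that X_simps by simp
  have N_f: "N (f x) = N x" if "x \<in> X" for x
    using iso[OF that X_simps(1)] by (simp add: f0)
  have "f (c *\<^sub>R x) = c *\<^sub>R f x" if x: "x \<in> X" for c x
  proof -
    define h where "h t = f (t *\<^sub>R x) - t *\<^sub>R f x" for t
    have h_add: "h (s + t) = h s + h t" for s t
      using add[of "s *\<^sub>R x" "t *\<^sub>R x"] x X_simps unfolding h_def by (simp add: scaleR_left_distrib)
    have h0: "h 0 = 0" and h1: "h 1 = 0" unfolding h_def by (simp_all add: f0)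
    have h_nat: "h (real m * t) = real m *\<^sub>R h t" for m t
    proof (induction m)
      case (Suc m)
      have "h (real (Suc m) * t) = h (real m * t + t)" by (simp add: algebra_simps)
      then show ?case using Suc h_add by (simp add: algebra_simps)
    qed (simp add: h0)
    have h_minus: "h (- t) = - h t" for t
      using h_add[of t "- t"] h0 by (simp add: eq_neg_iff_add_eq_0 add.commute)
    have h_int: "h (of_int m) = 0" for m
      using h_nat[of "nat m" 1] h_nat[of "nat (- m)" 1] h_minus[of "of_int (- m)"] h1
      by (cases "m \<ge> 0") auto
    have h_bound: "N (h t) \<le> 2 * \<bar>t\<bar> * N x" for t
    proof -
      have "N (h t) \<le> N (f (t *\<^sub>R x)) + N (- (t *\<^sub>R f x))"
        using is_normD(4)[OF N, of "f (t *\<^sub>R x)" "- (t *\<^sub>R f x)"] unfolding h_def by simp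
      then show ?thesis
        using x X_simps by (simp add: N_f is_normD(3,6)[OF N])
    qed
    have "real m * N (h c) \<le> 2 * N x" for m
    proof -
      define d where "d = real m * c - of_int \<lfloor>real m * c\<rfloor>"
      have d: "0 \<le> d" "d \<le> 1" unfolding d_def by linarith+
      have "real m *\<^sub>R h c = h (of_int \<lfloor>real m * c\<rfloor> + d)"
        unfolding d_def by (simp add: h_nat)
      also have "\<dots> = h d" by (simp add: h_add h_int)
      finally have "real m * N (h c) = N (h d)"
        by (metis abs_of_nat is_normD(3)[OF N])
      also have "\<dots> \<le> 2 * N x"
        using h_bound[of d] d is_normD(1)[OF N, of x] mult_right_mono[of d 1 "N x"] by simp
      finally show ?thesis .
    qed
    then have "N (h c) \<le> 0"
      using is_normD(1)[OF N, of x] by (metis mult.commute not_le reals_Archimedean3)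
    then have "h c = 0"
      using is_normD(1,2)[OF N] by (metis order_antisym)
    then show ?thesis unfolding h_def by simp
  qed
  with add show ?thesis unfolding real_linear_on_def by blast
qed

lemma isometry_inj_on:
  assumes N: "is_norm N"
    and iso: "\<And>x y. x \<in> X \<Longrightarrow> y \<in> X \<Longrightarrow> N (f x - f y) = N (x - y)"
  shows "inj_on f X"
proof (rule inj_onI)
  fix x y assume "x \<in> X" "y \<in> X" "f x = f y"
  then show "x = y"
    using iso[of x y] is_normD(2)[OF N, of "x - y"] is_normD(5)[OF N] by simp
qed

text \<open>
  The image is open by invariance of domain and closed by completeness, and \<open>X\<close> is connected.
\<close>
lemma isometry_surjective:
  fixes X :: "'a::euclidean_space set"
  assumes X: "subspace X" and N: "is_norm N"
    and maps: "\<And>x. x \<in> X \<Longrightarrow> f x \<in> X"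
    and iso: "\<And>x y. x \<in> X \<Longrightarrow> y \<in> X \<Longrightarrow> N (f x - f y) = N (x - y)"
  shows "f ` X = X"
proof -
  obtain C where C: "C > 0" "\<And>x. N x \<le> C * norm x"
    using norm_upper_bound[OF N] by blast
  obtain c where c: "c > 0" "\<And>x. c * norm x \<le> N x"
    using norm_lower_bound[OF N] by blast
  have "(C / c)-lipschitz_on X f"
  proof (rule lipschitz_onI)
    fix x y assume "x \<in> X" "y \<in> X"
    then have "c * norm (f x - f y) \<le> C * norm (x - y)"
      using C(2)[of "x - y"] c(2)[of "f x - f y"] iso by force
    then show "dist (f x) (f y) \<le> C / c * dist x y"
      using c(1) by (simp add: dist_norm field_simps)
  qed (use C c in auto)
  then have cont: "continuous_on X f"
    by (rule lipschitz_on_continuous_on)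
  have inj: "inj_on f X"
    using isometry_inj_on[OF N iso] .
  have "openin (top_of_set X) (f ` X)"
    using invariance_of_domain_subspaces[OF _ X X _ cont _ inj] maps by auto
  moreover have "closed (f ` X)"
    unfolding closed_sequential_limits
  proof (intro allI impI, elim conjE)
    fix s l assume s: "\<forall>n. s n \<in> f ` X" "s \<longlonglongrightarrow> l"
    then have "\<forall>n. \<exists>x. x \<in> X \<and> s n = f x" by blast
    from choice[OF this] obtain u where u: "\<And>n. u n \<in> X" "\<And>n. s n = f (u n)"
      by blast
    have "Cauchy u"
    proof (rule metric_CauchyI)
      fix e :: real assume e: "e > 0"
      have "e * c / C > 0" using C(1) c(1) e by simp
      then obtain M where M: "\<And>m n. m \<ge> M \<Longrightarrow> n \<ge> M \<Longrightarrow> dist (s m) (s n) < e * c / C"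
        using metric_CauchyD[OF LIMSEQ_imp_Cauchy[OF s(2)]] by blast
      have "dist (u m) (u n) < e" if "m \<ge> M" "n \<ge> M" for m n
      proof -
        have "c * norm (u m - u n) \<le> C * norm (s m - s n)"
          using c(2)[of "u m - u n"] C(2)[of "s m - s n"] iso[of "u m" "u n"] u by simp
        also have "\<dots> < c * e"
          using M[OF that] C(1) by (simp add: dist_norm field_simps)
        finally show ?thesis using c(1) by (simp add: dist_norm)
      qed
      then show "\<exists>M. \<forall>m\<ge>M. \<forall>n\<ge>M. dist (u m) (u n) < e" by blast
    qed
    then obtain x where x: "u \<longlonglongrightarrow> x"
      using Cauchy_convergent convergent_def by blast
    then have xX: "x \<in> X"
      using closed_subspace[OF X] u(1) closed_sequentially by blast
    then have "s \<longlonglongrightarrow> f x"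
      using continuous_on_tendsto_compose[OF cont x] u(1) by (simp flip: u(2))
    then show "l \<in> f ` X"
      using s(2) xX LIMSEQ_unique by blast
  qed
  then have "closedin (top_of_set X) (f ` X)"
    using maps by (intro closed_subset) auto
  moreover have "connected X"
    using X by (simp add: convex_connected subspace_imp_convex)
  moreover have "f ` X \<noteq> {}"
    using subspace_0[OF X] by blast
  ultimately show ?thesis
    unfolding connected_clopen by blast
qed

theorem mazur_ulam:
  fixes X :: "'a::euclidean_space set"
  assumes X: "subspace X" and N: "is_norm N"
    and maps: "\<And>x. x \<in> X \<Longrightarrow> f x \<in> X" and "f 0 = 0"
    and iso: "\<And>x y. x \<in> X \<Longrightarrow> y \<in> X \<Longrightarrow> N (f x - f y) = N (x - y)"
  shows "real_linear_on X f"
proof -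
  have "inj_on f X"
    using isometry_inj_on[OF N iso] .
  then have "surjective_isometry X N f"
    using isometry_surjective[OF X N maps iso] iso
    unfolding surjective_isometry_def bij_betw_def by blast
  then have "f ((1/2) *\<^sub>R (a + b)) = (1/2) *\<^sub>R (f a + f b)" if "a \<in> X" "b \<in> X" for a b
    using isometry_preserves_midpoint[OF X N that] by blast
  then show ?thesis
    by (intro midpoint_preserving_isometry_linear[OF X N maps assms(4) iso])
qed

section \<open>Real and complex matrices\<close>

text \<open>
  The real and the complex case share all arguments except the dimension counts. The axiom ties the
  involution to the norm; it determines the involution on real scalars and makes \<open>v\<^sup>* v\<close> positive.
  The real number is written as a multiple of 1 since \<^const>\<open>of_real\<close> is not an operation of the
  classes involved.
\<close>
class real_or_complex = real_normed_field + conjugatable_field + euclidean_space +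
  assumes conjugate_mult_self_scaleR: "conjugate x * x = (norm x)\<^sup>2 *\<^sub>R 1"

instance real :: real_or_complex
  by standard (simp add: power2_eq_square)

instance complex :: real_or_complex
  by standard (simp add: complex_norm_square[symmetric] mult.commute scaleR_conv_of_real)

lemma conjugate_mult_self: "conjugate x * x = of_real ((norm x)\<^sup>2)" for x :: "'f::real_or_complex"
  by (simp add: conjugate_mult_self_scaleR scaleR_conv_of_real)

lemma conjugate_of_real [simp]: "conjugate (of_real r) = (of_real r :: 'f::real_or_complex)"
proof (cases "r = 0")
  case False
  then show ?thesis
    using conjugate_mult_self[of "of_real r :: 'f"] by (simp add: power2_eq_square)
qed simp

lemma conjugate_1 [simp]: "conjugate 1 = (1 :: 'f::real_or_complex)"
  using conjugate_of_real[of 1] by simp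

lemma conjugate_scaleR: "conjugate (r *\<^sub>R x) = r *\<^sub>R conjugate (x :: 'f::real_or_complex)"
  by (simp add: scaleR_conv_of_real conjugate_dist_mul)

lemma bounded_bilinear_matrix_matrix_mult:
  "bounded_bilinear ((**) :: 'f::real_or_complex^'n^'m \<Rightarrow> 'f^'k^'n \<Rightarrow> 'f^'k^'m)"
proof -
  have "bilinear ((**) :: 'f::real_or_complex^'n^'m \<Rightarrow> 'f^'k^'n \<Rightarrow> 'f^'k^'m)"
    unfolding bilinear_def
    by (intro conjI allI linearI)
      (simp_all add: matrix_matrix_mult_def vec_eq_iff sum.distrib algebra_simps scaleR_sum_right)
  then show ?thesis
    by (simp add: bilinear_conv_bounded_bilinear)
qed

interpretation mm: bounded_bilinear "(**) :: 'f::real_or_complex^'n^'m \<Rightarrow> 'f^'k^'n \<Rightarrow> 'f^'k^'m"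
  by (rule bounded_bilinear_matrix_matrix_mult)

lemmas matrix_ring_simps =
  mm.add_left mm.add_right mm.diff_left mm.diff_right mm.minus_left mm.minus_right
  mm.scaleR_left mm.scaleR_right mm.zero_left mm.zero_right matrix_mul_assoc

lemma conj_transpose_nth [simp]: "conj_transpose a $ i $ j = conjugate (a $ j $ i)"
  by (simp add: conj_transpose_def map_matrix_def transpose_def)

lemma conj_transpose_involution [simp]: "conj_transpose (conj_transpose a) = a"
  by (simp add: vec_eq_iff)

lemma conj_transpose_mat:
  "conj_transpose (mat c :: 'f::real_or_complex^'n^'n) = mat (conjugate c)"
  by (simp add: vec_eq_iff mat_def)

lemma conj_transpose_mat_1 [simp]: "conj_transpose (mat 1 :: 'f::real_or_complex^'n^'n) = mat 1"
  by (simp add: conj_transpose_mat)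

lemma linear_conj_transpose:
  "linear (conj_transpose :: 'f::real_or_complex^'n^'m \<Rightarrow> 'f^'m^'n)"
  by (rule linearI) (simp_all add: vec_eq_iff conjugate_dist_add conjugate_scaleR)

lemmas conj_transpose_simps =
  linear_add[OF linear_conj_transpose] linear_diff[OF linear_conj_transpose]
  linear_neg[OF linear_conj_transpose] linear_scale[OF linear_conj_transpose]
  linear_0[OF linear_conj_transpose]

lemma conj_transpose_mult:
  "conj_transpose (a ** b) = conj_transpose b ** conj_transpose (a :: 'f::real_or_complex^'n^'m)"
  by (simp add: vec_eq_iff matrix_matrix_mult_def sum_conjugate conjugate_dist_mul mult.commute)

lemma tendsto_conj_transpose:
  fixes f :: "'c \<Rightarrow> 'f::real_or_complex^'n^'m"
  assumes "(f \<longlongrightarrow> l) F"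
  shows "((\<lambda>x. conj_transpose (f x)) \<longlongrightarrow> conj_transpose l) F"
  using assms linear_conj_transpose bounded_linear.tendsto linear_conv_bounded_linear by blast

lemma continuous_on_conj_transpose [continuous_intros]:
  fixes f :: "'c::topological_space \<Rightarrow> 'f::real_or_complex^'n^'m"
  assumes "continuous_on S f"
  shows "continuous_on S (\<lambda>x. conj_transpose (f x))"
  using assms unfolding continuous_on_def by (blast intro: tendsto_conj_transpose)

lemma mat_mult_commute: "mat c ** x = x ** (mat c :: 'f::real_or_complex^'n^'n)"
  by (simp add: vec_eq_iff matrix_matrix_mult_def mat_def if_distrib if_distribR mult.commute
      cong: if_cong)

lemma unitary_conj_transpose: "u \<in> unitary_matrices \<Longrightarrow> conj_transpose u \<in> unitary_matrices"
  unfolding unitary_matrices_def by simp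

lemma unitary_mult:
  fixes u w :: "'f::real_or_complex^'n^'n"
  assumes "u \<in> unitary_matrices" "w \<in> unitary_matrices"
  shows "u ** w \<in> unitary_matrices"
proof -
  have "conj_transpose w ** (conj_transpose u ** u) ** w = mat 1"
    "u ** (w ** conj_transpose w) ** conj_transpose u = mat 1"
    using assms unfolding unitary_matrices_def by auto
  then show ?thesis
    unfolding unitary_matrices_def by (simp add: conj_transpose_mult matrix_mul_assoc)
qed

lemma norm_unitary_entry_le_1:
  fixes u :: "'f::real_or_complex^'n^'n"
  assumes "u \<in> unitary_matrices"
  shows "norm (u $ i $ j) \<le> 1"
proof -
  have "(\<Sum>k\<in>UNIV. conjugate (u $ k $ j) * u $ k $ j) = (conj_transpose u ** u) $ j $ j"
    by (simp add: matrix_matrix_mult_def)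
  also have "\<dots> = 1"
    using assms unfolding unitary_matrices_def by (simp add: mat_def)
  finally have "(\<Sum>k\<in>UNIV. (norm (u $ k $ j))\<^sup>2) = 1"
    by (simp only: conjugate_mult_self of_real_sum[symmetric] of_real_eq_1_iff)
  then have "(norm (u $ i $ j))\<^sup>2 \<le> 1"
    using member_le_sum[of i UNIV "\<lambda>k. (norm (u $ k $ j))\<^sup>2"] by simp
  then show ?thesis
    by (simp add: power2_le_imp_le abs_square_le_1)
qed

lemma compact_unitary_matrices: "compact (unitary_matrices :: ('f::real_or_complex^'n^'n) set)"
proof -
  have "norm u \<le> (\<Sum>i\<in>(UNIV::'n set). \<Sum>j\<in>(UNIV::'n set). 1)"
    if "u \<in> unitary_matrices" for u :: "'f^'n^'n"
  proof -
    have "norm u \<le> (\<Sum>i\<in>UNIV. norm (u $ i))"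
      unfolding norm_vec_def by (simp add: L2_set_le_sum)
    also have "\<dots> \<le> (\<Sum>i\<in>UNIV. \<Sum>j\<in>UNIV. norm (u $ i $ j))"
      by (intro sum_mono) (simp add: norm_vec_def L2_set_le_sum)
    also have "\<dots> \<le> (\<Sum>i\<in>(UNIV::'n set). \<Sum>j\<in>(UNIV::'n set). 1)"
      by (intro sum_mono norm_unitary_entry_le_1 that)
    finally show ?thesis .
  qed
  then have "bounded (unitary_matrices :: ('f^'n^'n) set)"
    unfolding bounded_iff by blast
  moreover have "closed (unitary_matrices :: ('f^'n^'n) set)"
    unfolding unitary_matrices_def
    by (intro closed_Collect_conj closed_Collect_eq mm.continuous_on continuous_intros)
  ultimately show ?thesis
    by (simp add: compact_eq_bounded_closed)
qed

definition skew_hermitian_matrices :: "('f::real_or_complex^'n^'n) set"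
  where "skew_hermitian_matrices = {a. conj_transpose a = - a}"

lemma subspace_skew_hermitian: "subspace skew_hermitian_matrices"
  unfolding skew_hermitian_matrices_def subspace_def by (auto simp: conj_transpose_simps)

lemma subspace_hermitian: "subspace (hermitian_matrices :: ('f::real_or_complex^'n^'n) set)"
  unfolding hermitian_matrices_def subspace_def by (auto simp: conj_transpose_simps)

lemma skew_hermitianD: "a \<in> skew_hermitian_matrices \<Longrightarrow> conjugate (a $ i $ j) = - a $ j $ i"
proof -
  assume "a \<in> skew_hermitian_matrices"
  then have "conj_transpose a $ j $ i = (- a) $ j $ i"
    by (simp only: skew_hermitian_matrices_def mem_Collect_eq)
  then show ?thesis by simp
qed

text \<open>
  The number \<open>v\<^sup>* a v\<close> is its own negative conjugate, and equals the squared length of \<open>v\<close> if \<open>a v = v\<close>.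
\<close>
lemma skew_hermitian_eigenvector_trivial:
  fixes a :: "'f::real_or_complex^'n^'n"
  assumes a: "a \<in> skew_hermitian_matrices" and v: "a *v v = v"
  shows "v = 0"
proof -
  define q where "q = (\<Sum>i\<in>UNIV. conjugate (v $ i) * (a *v v) $ i)"
  note a' = skew_hermitianD[OF a]
  have "conjugate q = (\<Sum>i\<in>UNIV. \<Sum>j\<in>UNIV. v $ i * (conjugate (a $ i $ j) * conjugate (v $ j)))"
    unfolding q_def matrix_vector_mult_def
    by (simp add: sum_conjugate conjugate_dist_mul sum_distrib_left)
  also have "\<dots> = (\<Sum>j\<in>UNIV. \<Sum>i\<in>UNIV. v $ i * (- a $ j $ i * conjugate (v $ j)))"
    unfolding a' by (rule sum.swap)
  also have "\<dots> = - q"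
    unfolding q_def matrix_vector_mult_def
    by (simp add: sum_distrib_left sum_negf mult.commute mult.left_commute)
  finally have "conjugate q = - q" .
  moreover have q: "q = of_real (\<Sum>i\<in>UNIV. (norm (v $ i))\<^sup>2)"
    unfolding q_def v conjugate_mult_self by simp
  then have "conjugate q = q" by (simp only: conjugate_of_real)
  ultimately have "q + q = 0" by (metis add.right_inverse)
  then have "2 * q = 0" by (simp only: mult_2)
  then have "q = 0" by simp
  then have "(\<Sum>i\<in>UNIV. (norm (v $ i))\<^sup>2) = 0"
    using q by (metis of_real_eq_0_iff)
  then show ?thesis
    by (simp add: sum_nonneg_eq_0_iff vec_eq_iff)
qed

text \<open>
  The path is the Cayley transform \<open>(1 + t a / 2) (1 - t a / 2)\<^sup>-\<^sup>1\<close>. Writing \<open>C t\<close> for the second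
  factor, it equals \<open>2 C t - 1\<close>. Compactness of the unitary group thus bounds \<open>C t\<close>, and the identity
  \<open>u t - u s = (t - s) C t a C s\<close> yields both continuity and the derivative \<open>a\<close> at 0.
\<close>
lemma skew_hermitian_unitary_path:
  fixes a :: "'f::real_or_complex^'n^'n"
  assumes a: "a \<in> skew_hermitian_matrices"
  obtains u :: "real \<Rightarrow> 'f^'n^'n" where "\<And>t. u t \<in> unitary_matrices" "u 0 = mat 1"
    "continuous_on UNIV u" "(u has_vector_derivative a) (at 0)"
proof -
  define M where "M t = mat 1 - (t / 2) *\<^sub>R a" for t
  have M_star: "conj_transpose (M t) = mat 1 + (t / 2) *\<^sub>R a" for t
    using a unfolding M_def skew_hermitian_matrices_def by (simp add: conj_transpose_simps)
  have "\<exists>C. C ** M t = mat 1" for t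
    unfolding matrix_left_invertible_ker
  proof (intro allI impI)
    fix v assume "M t *v v = 0"
    then have "((t / 2) *\<^sub>R a) *v v = v"
      unfolding M_def by (simp add: matrix_vector_mult_diff_rdistrib)
    moreover have "(t / 2) *\<^sub>R a \<in> skew_hermitian_matrices"
      by (rule subspace_scale[OF subspace_skew_hermitian a])
    ultimately show "v = 0"
      using skew_hermitian_eigenvector_trivial by blast
  qed
  then obtain C where C: "\<And>t. C t ** M t = mat 1" by metis
  have C': "M t ** C t = mat 1" for t
    using C matrix_left_right_inverse by blast
  define u where "u t = conj_transpose (M t) ** C t" for t
  have u_C: "u t = 2 *\<^sub>R C t - mat 1" for t
  proof -
    have "conj_transpose (M t) = 2 *\<^sub>R mat 1 - M t"
      unfolding M_star unfolding M_def by (simp add: scaleR_2)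
    then show ?thesis
      unfolding u_def using C'[of t] by (simp add: matrix_ring_simps)
  qed
  have "(mat 1 - b) ** (mat 1 + b) = (mat 1 + b) ** (mat 1 - b)" for b :: "'f^'n^'n"
    by (simp add: mm.add_left mm.add_right mm.diff_left mm.diff_right)
  then have comm: "M t ** conj_transpose (M t) = conj_transpose (M t) ** M t" for t
    unfolding M_star unfolding M_def .
  have uni: "u t \<in> unitary_matrices" for t
  proof -
    have "conj_transpose (u t) ** u t
        = conj_transpose (C t) ** (M t ** conj_transpose (M t)) ** C t"
      unfolding u_def by (simp add: conj_transpose_mult matrix_mul_assoc)
    also have "\<dots> = conj_transpose (M t ** C t) ** (M t ** C t)"
      unfolding comm by (simp add: conj_transpose_mult matrix_mul_assoc)
    finally have "conj_transpose (u t) ** u t = mat 1"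
      unfolding C' by simp
    then show ?thesis
      using matrix_left_right_inverse unfolding unitary_matrices_def by blast
  qed
  have C_u: "C t = (1/2) *\<^sub>R (u t + mat 1)" for t
    unfolding u_C by simp
  have diff: "u t - u s = (t - s) *\<^sub>R (C t ** a ** C s)" for t s
  proof -
    have "C t - C s = C t ** (M s ** C s) - (C t ** M t) ** C s"
      unfolding C C' by simp
    also have "\<dots> = C t ** (M s - M t) ** C s"
      by (simp add: matrix_ring_simps)
    also have "M s - M t = ((t - s) / 2) *\<^sub>R a"
      unfolding M_def by (simp add: diff_divide_distrib scaleR_left_diff_distrib)
    finally show ?thesis
      unfolding u_C by (simp add: matrix_ring_simps flip: scaleR_right_diff_distrib)
  qed
  obtain B where B: "\<And>u :: 'f^'n^'n. u \<in> unitary_matrices \<Longrightarrow> norm u \<le> B"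
    using compact_imp_bounded[OF compact_unitary_matrices] unfolding bounded_iff by blast
  obtain K where K: "K > 0" "\<And>(x :: 'f^'n^'n) (y :: 'f^'n^'n). norm (x ** y) \<le> norm x * norm y * K"
    using mm.pos_bounded by blast
  define L where "L = (B + norm (mat 1 :: 'f^'n^'n)) / 2"
  have C_bound: "norm (C t) \<le> L" for t
    unfolding C_u L_def using B[OF uni[of t]] norm_triangle_ineq[of "u t" "mat 1"] by simp
  have L0: "L \<ge> 0" using C_bound[of 0] norm_ge_zero order_trans by blast
  have "(L * norm a * K * L * K)-lipschitz_on UNIV u"
  proof (rule lipschitz_onI)
    fix t s
    have "norm (C t ** a ** C s) \<le> norm (C t ** a) * norm (C s) * K"
      by (rule K(2))
    also have "\<dots> \<le> (norm (C t) * norm a * K) * L * K"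
      using K C_bound L0 by (intro mult_right_mono mult_mono) auto
    also have "\<dots> \<le> (L * norm a * K) * L * K"
      using K C_bound L0 by (intro mult_right_mono) auto
    finally show "dist (u t) (u s) \<le> L * norm a * K * L * K * dist t s"
      unfolding dist_norm diff by (simp add: mult.commute mult_left_mono)
  qed (use K L0 in auto)
  then have cont: "continuous_on UNIV u"
    by (rule lipschitz_on_continuous_on)
  have "M 0 = mat 1" unfolding M_def by simp
  then have C0: "C 0 = mat 1" using C[of 0] by simp
  then have u0: "u 0 = mat 1" unfolding u_C by (simp add: scaleR_2)
  have "(u \<longlongrightarrow> mat 1) (at 0)"
    using cont u0 by (metis UNIV_I continuous_on_def)
  then have "((\<lambda>t. C t) \<longlongrightarrow> (1/2) *\<^sub>R (mat 1 + mat 1)) (at 0)"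
    unfolding C_u by (intro tendsto_intros)
  then have "((\<lambda>t. C t ** a ** C 0) \<longlongrightarrow> ((1/2) *\<^sub>R (mat 1 + mat 1)) ** a ** mat 1) (at 0)"
    unfolding C0 by (intro mm.tendsto tendsto_const)
  then have "((\<lambda>t. C t ** a ** C 0) \<longlongrightarrow> a) (at 0)"
    by (simp add: matrix_ring_simps flip: scaleR_2)
  then have "((\<lambda>t. (1 / t) *\<^sub>R (u t - u 0)) \<longlongrightarrow> a) (at 0)"
    by (rule Lim_transform_eventually) (auto simp: eventually_at diff intro!: exI[of _ 1])
  then have "(u has_vector_derivative a) (at 0)"
    unfolding has_vector_derivative_iff_quotient_tendsto .
  then show thesis
    using that uni u0 cont by blast
qed

section \<open>Infinitesimal unitary conjugations\<close>

lemma matrix_unit_nth: "matrix_unit i j $ a $ b = (if a = i \<and> b = j then 1 else 0)"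
  by (simp add: matrix_unit_def)

lemma mat_mult_nth: "(mat c ** x) $ i $ j = c * (x :: 'f::real_or_complex^'n^'n) $ i $ j"
proof -
  have "(mat c ** x) $ i $ j = (\<Sum>k\<in>UNIV. if i = k then c * x $ k $ j else 0)"
    unfolding matrix_matrix_mult_def mat_def vec_lambda_beta by (rule sum.cong) auto
  then show ?thesis by simp
qed

lemma mult_matrix_unit_nth:
  "(x ** matrix_unit i k) $ a $ b = (if b = k then (x :: 'f::real_or_complex^'n^'n) $ a $ i else 0)"
proof -
  have "(x ** matrix_unit i k) $ a $ b = (\<Sum>j\<in>UNIV. if j = i then (if b = k then x $ a $ j else 0) else 0)"
    unfolding matrix_matrix_mult_def vec_lambda_beta matrix_unit_nth by (rule sum.cong) auto
  then show ?thesis by simp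
qed

lemma matrix_unit_mult_nth:
  "(matrix_unit k i ** x) $ a $ b = (if a = k then (x :: 'f::real_or_complex^'n^'n) $ i $ b else 0)"
proof -
  have "(matrix_unit k i ** x) $ a $ b = (\<Sum>j\<in>UNIV. if j = i then (if a = k then x $ j $ b else 0) else 0)"
    unfolding matrix_matrix_mult_def vec_lambda_beta matrix_unit_nth by (rule sum.cong) auto
  then show ?thesis by simp
qed

lemma matrix_unit_mult:
  "(matrix_unit i j :: 'f::real_or_complex^'n^'n) ** matrix_unit k l = (if j = k then matrix_unit i l else 0)"
  by (auto simp: vec_eq_iff mult_matrix_unit_nth matrix_unit_nth)

lemma mult_matrix_unit:
  fixes x :: "'f::real_or_complex^'n^'n"
  shows "x ** matrix_unit i k = (\<Sum>j\<in>UNIV. mat (x $ j $ i) ** matrix_unit j k)"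
proof -
  have "(\<Sum>j\<in>UNIV. mat (x $ j $ i) ** matrix_unit j k) $ a $ b
      = (\<Sum>j\<in>UNIV. if j = a then (if b = k then x $ j $ i else 0) else 0)" for a b
    unfolding sum_component mat_mult_nth matrix_unit_nth by (rule sum.cong) auto
  then show ?thesis
    by (simp add: vec_eq_iff mult_matrix_unit_nth)
qed

lemma matrix_unit_mult_left:
  fixes x :: "'f::real_or_complex^'n^'n"
  shows "matrix_unit k j ** x = (\<Sum>i\<in>UNIV. mat (x $ j $ i) ** matrix_unit k i)"
proof -
  have "(\<Sum>i\<in>UNIV. mat (x $ j $ i) ** matrix_unit k i) $ a $ b
      = (\<Sum>i\<in>UNIV. if i = b then (if a = k then x $ j $ i else 0) else 0)" for a b
    unfolding sum_component mat_mult_nth matrix_unit_nth by (rule sum.cong) auto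
  then show ?thesis
    by (simp add: vec_eq_iff matrix_unit_mult_nth)
qed

lemma sum_diagonal_matrix_units:
  "(\<Sum>i\<in>UNIV. matrix_unit i i) = (mat 1 :: 'f::real_or_complex^'n^'n)"
proof -
  have "(\<Sum>i\<in>UNIV. matrix_unit i i :: 'f^'n^'n) $ a $ b
      = (\<Sum>i\<in>UNIV. if i = a then (if a = b then 1 else 0) else 0)" for a b
    unfolding sum_component matrix_unit_nth by (rule sum.cong) auto
  then show ?thesis
    by (simp add: vec_eq_iff mat_def)
qed

lemma matrix_eq_sum_units:
  fixes x :: "'f::real_or_complex^'n^'n"
  shows "x = (\<Sum>i\<in>UNIV. \<Sum>j\<in>UNIV. mat (x $ i $ j) ** matrix_unit i j)"
proof -
  have "x = (\<Sum>i\<in>UNIV. matrix_unit i i ** x)"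
    by (simp add: sum_diagonal_matrix_units flip: mm.sum_left)
  then show ?thesis
    unfolding matrix_unit_mult_left .
qed

lemma mat_mult_left_commute:
  "(mat c ** x) ** y = x ** (mat c ** (y :: 'f::real_or_complex^'n^'n))"
  by (subst mat_mult_commute) (rule matrix_mul_assoc[symmetric])

lemma conj_transpose_matrix_unit:
  "conj_transpose (matrix_unit i j :: 'f::real_or_complex^'n^'n) = matrix_unit j i"
proof -
  have "conj_transpose (matrix_unit i j :: 'f^'n^'n) $ a $ b = matrix_unit j i $ a $ b" for a b
    unfolding conj_transpose_nth matrix_unit_nth by (cases "a = j"; cases "b = i") simp_all
  then show ?thesis unfolding vec_eq_iff by blast
qed

lemma hermitian_units:
  "matrix_unit i i \<in> (hermitian_matrices :: ('f::real_or_complex^'n^'n) set)"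
  "matrix_unit i j + matrix_unit j i \<in> (hermitian_matrices :: ('f::real_or_complex^'n^'n) set)"
  unfolding hermitian_matrices_def mem_Collect_eq linear_add[OF linear_conj_transpose]
    conj_transpose_matrix_unit by (rule refl, rule add.commute)

text \<open>
  The classical formula \<open>a = \<Sum>\<^sub>i \<delta>(e\<^sub>i\<^sub>k) e\<^sub>k\<^sub>i\<close> for a fixed index \<open>k\<close>. Vanishing on scalar matrices makes
  the derivation linear over the scalar field, as the Leibniz rule shows.
\<close>
lemma derivation_is_inner:
  fixes \<delta> :: "'f::real_or_complex^'n^'n \<Rightarrow> 'f^'n^'n"
  assumes add: "\<And>x y. \<delta> (x + y) = \<delta> x + \<delta> y"
    and scalar: "\<And>c. \<delta> (mat c) = 0"
    and mult: "\<And>x y. \<delta> (x ** y) = \<delta> x ** y + x ** \<delta> y"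
  obtains a where "\<And>x. \<delta> x = a ** x - x ** a"
proof -
  \<comment> \<open>any index will do\<close>
  fix k :: 'n
  define a where "a = (\<Sum>i\<in>UNIV. \<delta> (matrix_unit i k) ** matrix_unit k i)"
  have zero: "\<delta> 0 = 0" using add[of 0 0] by simp
  have sum: "\<delta> (\<Sum>i\<in>I. f i) = (\<Sum>i\<in>I. \<delta> (f i))" if "finite I" for f and I :: "'n set"
    using that by (induction I) (simp_all add: zero add)
  have scale: "\<delta> (mat c ** x) = mat c ** \<delta> x" for c x
    by (simp add: mult scalar)
  have "\<delta> x = a ** x - x ** a" for x
  proof -
    have "x ** a = (\<Sum>i\<in>UNIV. (x ** \<delta> (matrix_unit i k)) ** matrix_unit k i)"
      unfolding a_def by (simp add: mm.sum_right matrix_mul_assoc)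
    also have "\<dots> = (\<Sum>i\<in>UNIV. \<delta> (x ** matrix_unit i k) ** matrix_unit k i
        - \<delta> x ** (matrix_unit i k ** matrix_unit k i))"
      by (simp add: mult mm.add_left matrix_mul_assoc)
    also have "\<dots> = (\<Sum>i\<in>UNIV. \<delta> (x ** matrix_unit i k) ** matrix_unit k i)
        - \<delta> x ** (\<Sum>i\<in>UNIV. matrix_unit i i)"
      unfolding sum_subtractf mm.sum_right by (simp add: matrix_unit_mult)
    also have "(\<Sum>i\<in>UNIV. \<delta> (x ** matrix_unit i k) ** matrix_unit k i)
        = (\<Sum>i\<in>UNIV. \<Sum>j\<in>UNIV. \<delta> (matrix_unit j k) ** (mat (x $ j $ i) ** matrix_unit k i))"
      unfolding mult_matrix_unit[of x] sum[OF finite] scale mm.sum_left mat_mult_left_commute ..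
    also have "\<dots> = (\<Sum>j\<in>UNIV. \<delta> (matrix_unit j k) ** (matrix_unit k j ** x))"
      unfolding matrix_unit_mult_left mm.sum_right by (rule sum.swap)
    also have "\<dots> = a ** x"
      unfolding a_def by (simp add: mm.sum_left matrix_mul_assoc)
    finally show ?thesis
      by (simp add: sum_diagonal_matrix_units)
  qed
  then show thesis by (rule that)
qed

text \<open>
  If \<open>b\<close> implements \<open>\<delta>\<close>, then compatibility with the conjugate transpose says that \<open>- b\<^sup>*\<close> implements it
  too, and so does the mean of \<open>b\<close> and \<open>- b\<^sup>*\<close>.
\<close>
lemma star_derivation_is_inner_skew:
  fixes \<delta> :: "'f::real_or_complex^'n^'n \<Rightarrow> 'f^'n^'n"
  assumes "\<And>x y. \<delta> (x + y) = \<delta> x + \<delta> y" "\<And>c. \<delta> (mat c) = 0"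
    and "\<And>x y. \<delta> (x ** y) = \<delta> x ** y + x ** \<delta> y"
    and star: "\<And>x. \<delta> (conj_transpose x) = conj_transpose (\<delta> x)"
  obtains a where "a \<in> skew_hermitian_matrices" "\<And>x. \<delta> x = a ** x - x ** a"
proof -
  obtain b where b: "\<And>x. \<delta> x = b ** x - x ** b"
    using derivation_is_inner[of \<delta>] assms(1-3) by blast
  define a where "a = (1/2) *\<^sub>R (b - conj_transpose b)"
  have skew: "a \<in> skew_hermitian_matrices"
    unfolding a_def skew_hermitian_matrices_def
    by (simp add: conj_transpose_simps flip: scaleR_minus_right)
  have "\<delta> x = x ** conj_transpose b - conj_transpose b ** x" for x
  proof -
    have "\<delta> x = conj_transpose (\<delta> (conj_transpose x))" by (simp add: star)
    also have "\<dots> = x ** conj_transpose b - conj_transpose b ** x"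
      unfolding b by (simp add: conj_transpose_simps conj_transpose_mult)
    finally show ?thesis .
  qed
  note eq = arg_cong2[where f = "(+)", OF b this]
  have "\<delta> x = a ** x - x ** a" for x
  proof -
    have "a ** x - x ** a = (1/2) *\<^sub>R ((b - conj_transpose b) ** x - x ** (b - conj_transpose b))"
      by (simp add: a_def matrix_ring_simps scaleR_right_diff_distrib)
    also have "(b - conj_transpose b) ** x - x ** (b - conj_transpose b) = \<delta> x + \<delta> x"
      unfolding eq mm.diff_left mm.diff_right by (simp add: algebra_simps)
    finally show ?thesis by (simp flip: scaleR_2)
  qed
  then show thesis using skew that by blast
qed

text \<open>
  Conjugations are multiplicative and fix scalar matrices, so by the Leibniz rule for difference
  quotients the matrices at which the quotients converge form a ring containing the scalar
  matrices. Hermitian matrices generate it: for \<open>i \<noteq> j\<close> the matrix unit \<open>e\<^sub>i\<^sub>j\<close> is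
  \<open>e\<^sub>i\<^sub>i (e\<^sub>i\<^sub>j + e\<^sub>j\<^sub>i)\<close>.
\<close>
lemma unitary_conjugations_derivative:
  fixes u :: "nat \<Rightarrow> 'f::real_or_complex^'n^'n" and t :: "nat \<Rightarrow> real"
  assumes u: "\<And>n. u n \<in> unitary_matrices" and t: "t \<longlonglongrightarrow> 0" "\<And>n. t n \<noteq> 0"
    and herm: "\<And>x. x \<in> hermitian_matrices \<Longrightarrow>
      convergent (\<lambda>n. (1 / t n) *\<^sub>R (u n ** x ** conj_transpose (u n) - x))"
  shows "\<exists>a\<in>skew_hermitian_matrices. \<forall>x.
    (\<lambda>n. (1 / t n) *\<^sub>R (u n ** x ** conj_transpose (u n) - x)) \<longlonglongrightarrow> a ** x - x ** a"
proof -
  define c where "c n x = u n ** x ** conj_transpose (u n)" for n x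
  define Q where "Q x n = (1 / t n) *\<^sub>R (c n x - x)" for x n
  have uu: "conj_transpose (u n) ** u n = mat 1" "u n ** conj_transpose (u n) = mat 1" for n
    using u unfolding unitary_matrices_def by auto
  have c_mult: "c n (x ** y) = c n x ** c n y" for n x y
  proof -
    have "c n x ** c n y = u n ** x ** (conj_transpose (u n) ** u n) ** y ** conj_transpose (u n)"
      unfolding c_def by (simp only: matrix_mul_assoc)
    then show ?thesis
      unfolding uu c_def by (simp add: matrix_mul_assoc)
  qed
  have c_mat: "c n (mat s) = mat s" for n s
    unfolding c_def mat_mult_commute[of s "u n", symmetric]
    by (simp add: uu flip: matrix_mul_assoc)
  have Q_add: "Q (x + y) n = Q x n + Q y n" for x y n
    unfolding Q_def c_def by (simp add: matrix_ring_simps algebra_simps)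
  have Q_mat: "Q (mat s) n = 0" for s n
    unfolding Q_def c_mat by simp
  have Q_mult: "Q (x ** y) n = Q x n ** c n y + x ** Q y n" for x y n
    unfolding Q_def c_mult by (simp add: matrix_ring_simps scaleR_right_diff_distrib)
  have Q_star: "Q (conj_transpose x) n = conj_transpose (Q x n)" for x n
    unfolding Q_def c_def by (simp add: conj_transpose_simps conj_transpose_mult matrix_mul_assoc)
  have c_lim: "(\<lambda>n. c n x) \<longlonglongrightarrow> x" if conv: "convergent (Q x)" for x
  proof -
    obtain q where "Q x \<longlonglongrightarrow> q" using conv unfolding convergent_def by blast
    then have "(\<lambda>n. x + t n *\<^sub>R Q x n) \<longlonglongrightarrow> x + 0 *\<^sub>R q"
      by (intro tendsto_intros t(1))
    moreover have "x + t n *\<^sub>R Q x n = c n x" for n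
      unfolding Q_def using t(2)[of n] by simp
    ultimately show ?thesis by simp
  qed
  have Q_mult_lim: "Q (x ** y) \<longlonglongrightarrow> p ** y + x ** q" if "Q x \<longlonglongrightarrow> p" "Q y \<longlonglongrightarrow> q" for x y p q
  proof -
    have "(\<lambda>n. Q x n ** c n y + x ** Q y n) \<longlonglongrightarrow> p ** y + x ** q"
      using that by (intro tendsto_add mm.tendsto tendsto_const c_lim) (auto simp: convergent_def)
    then show ?thesis
      by (simp flip: Q_mult)
  qed
  then have conv_mult: "convergent (Q (x ** y))" if "convergent (Q x)" "convergent (Q y)" for x y
    using that unfolding convergent_def by blast
  have conv_mat: "convergent (Q (mat s))" for s
    unfolding Q_mat[abs_def] by (rule convergent_const)
  have Q_zero: "Q 0 n = 0" for n using Q_mat[of 0 n] by simp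
  have Q_sum: "Q (\<Sum>i\<in>I. f i) n = (\<Sum>i\<in>I. Q (f i) n)" if "finite I" for f and I :: "'n set" and n
    using that by (induction I) (simp_all add: Q_zero Q_add)
  have conv_unit: "convergent (Q (matrix_unit i j))" for i j
  proof (cases "i = j")
    case True
    then show ?thesis
      using herm[OF hermitian_units(1)[of i]] unfolding Q_def c_def by simp
  next
    case False
    have "matrix_unit i i ** (matrix_unit i j + matrix_unit j i) = (matrix_unit i j :: 'f^'n^'n)"
      using False by (simp add: mm.add_right matrix_unit_mult)
    then show ?thesis
      using conv_mult[of "matrix_unit i i" "matrix_unit i j + matrix_unit j i"]
        herm[OF hermitian_units(1)[of i]] herm[OF hermitian_units(2)[of i j]]
      unfolding Q_def c_def by simp
  qed
  have conv: "convergent (Q x)" for x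
  proof -
    have "convergent (\<lambda>n. \<Sum>i\<in>UNIV. \<Sum>j\<in>UNIV. Q (mat (x $ i $ j) ** matrix_unit i j) n)"
      by (intro convergent_sum conv_mult conv_mat conv_unit)
    moreover have "(\<Sum>i\<in>UNIV. \<Sum>j\<in>UNIV. Q (mat (x $ i $ j) ** matrix_unit i j) n) = Q x n" for n
      by (subst (2) matrix_eq_sum_units[of x]) (simp add: Q_sum)
    ultimately show ?thesis by simp
  qed
  define \<delta> where "\<delta> x = lim (Q x)" for x
  have \<delta>: "Q x \<longlonglongrightarrow> \<delta> x" for x
    using conv unfolding \<delta>_def by (simp add: convergent_LIMSEQ_iff)
  have "\<delta> (x + y) = \<delta> x + \<delta> y" for x y
    using tendsto_add[OF \<delta>[of x] \<delta>[of y]] \<delta>[of "x + y"] LIMSEQ_unique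
    by (simp add: Q_add[abs_def]) blast
  moreover have "\<delta> (mat s) = 0" for s
    using \<delta>[of "mat s"] LIMSEQ_unique[OF _ tendsto_const] unfolding Q_mat[abs_def] by metis
  moreover have "\<delta> (x ** y) = \<delta> x ** y + x ** \<delta> y" for x y
    using Q_mult_lim[OF \<delta> \<delta>] \<delta> LIMSEQ_unique by blast
  moreover have "\<delta> (conj_transpose x) = conj_transpose (\<delta> x)" for x
    using \<delta>[of "conj_transpose x"] tendsto_conj_transpose[OF \<delta>[of x]] LIMSEQ_unique
    by (simp add: Q_star[abs_def]) blast
  ultimately obtain a where "a \<in> skew_hermitian_matrices" "\<And>x. \<delta> x = a ** x - x ** a"
    using star_derivation_is_inner_skew[of \<delta>] by blast
  then show ?thesis
    using \<delta> unfolding Q_def c_def by (intro bexI[of _ a]) simp_all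
qed

section \<open>Rigid motions of matrix spaces\<close>

text \<open>
  The properties of an admissible matrix space that determine its rigid motions, for a subspace
  containing the hermitian matrices.
\<close>
locale unitary_matrix_space =
  fixes X :: "('f::real_or_complex^'n^'n) set" and N :: "'f^'n^'n \<Rightarrow> real"
    and \<Gamma> :: "('f^'n^'n \<Rightarrow> 'f^'n^'n) set"
  assumes X: "subspace X" and N: "is_norm N" and invariant: "unitarily_invariant N"
    and hermitian: "hermitian_matrices \<subseteq> X"
    and test: "test_set \<Gamma>" and large: "test_large \<Gamma> X"
    and isometries: "test_isometry_property \<Gamma> X N"
begin

lemma zero_in: "0 \<in> X" and one_in: "mat 1 \<in> X"
  using subspace_0[OF X] large unfolding test_large_def by auto

lemma commutant_scalar:
  assumes "\<And>x. x \<in> X \<Longrightarrow> x ** y = y ** x"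
  obtains c where "y = mat c"
proof -
  have "y \<in> twisted_commutant \<Gamma> X"
    using assms test unfolding twisted_commutant_def test_set_def by (auto intro!: bexI[of _ id])
  then show thesis
    using large that unfolding test_large_def by blast
qed

lemma rigid_motion_unitary_form:
  assumes \<alpha>: "rigid_motion X N \<alpha>" and s: "s \<in> {-1..1}"
  shows "\<exists>u w \<gamma>. u \<in> unitary_matrices \<and> w \<in> unitary_matrices \<and> \<gamma> \<in> \<Gamma> \<and>
    (\<forall>x\<in>X. \<alpha> x s - \<alpha> 0 s = u ** \<gamma> x ** w)"
proof -
  define A where "A x = \<alpha> x s - \<alpha> 0 s" for x
  have in_X: "\<alpha> x s \<in> X" if "x \<in> X" for x
    using \<alpha> s that unfolding rigid_motion_def by blast
  have maps: "A x \<in> X" if "x \<in> X" for x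
    unfolding A_def using in_X[OF that] in_X[OF zero_in] by (rule subspace_diff[OF X])
  have iso: "N (A x - A y) = N (x - y)" if "x \<in> X" "y \<in> X" for x y
    using \<alpha> s that unfolding rigid_motion_def A_def by simp
  have "real_linear_on X A"
    by (rule mazur_ulam[OF X N maps _ iso]) (simp_all add: A_def)
  then show ?thesis
    using isometries maps iso unfolding test_isometry_property_def A_def[symmetric] by blast
qed

text \<open>
  The map \<open>\<gamma>\<close> and the unitary matrices may depend on the time in an arbitrary way. Finiteness of the
  test set and compactness of the unitary group provide a sequence of times along which \<open>\<gamma>\<close> is
  constant and the unitary matrices converge. In the limit \<open>x = u \<gamma>(x) w\<close>, that is, \<open>x u = u \<gamma>(x)\<close>, so
  \<open>u\<close> is scalar by largeness and \<open>\<gamma>\<close> is the identity on \<open>X\<close>.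
\<close>
lemma rigid_motion_unitary_sequence:
  assumes \<alpha>: "rigid_motion X N \<alpha>"
  obtains t :: "nat \<Rightarrow> real" and u w :: "nat \<Rightarrow> 'f^'n^'n"
  where "t \<longlonglongrightarrow> 0" "\<And>n. t n \<noteq> 0" "\<And>n. t n \<in> {-1..1}"
    "\<And>n. u n \<in> unitary_matrices" "\<And>n. w n \<in> unitary_matrices"
    "\<And>n x. x \<in> X \<Longrightarrow> \<alpha> x (t n) - \<alpha> 0 (t n) = u n ** x ** w n"
proof -
  define s where "s n = inverse (real (Suc n))" for n
  have s: "s n \<in> {-1..1}" "s n \<noteq> 0" for n
    unfolding s_def by (auto simp: field_simps)
  have s0: "s \<longlonglongrightarrow> 0"
    unfolding s_def by (rule LIMSEQ_inverse_real_of_nat)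
  have "\<forall>n. \<exists>T. fst T \<in> unitary_matrices \<and> fst (snd T) \<in> unitary_matrices \<and> snd (snd T) \<in> \<Gamma> \<and>
      (\<forall>x\<in>X. \<alpha> x (s n) - \<alpha> 0 (s n) = fst T ** snd (snd T) x ** fst (snd T))"
    using rigid_motion_unitary_form[OF \<alpha> s(1)] by auto
  from choice[OF this] obtain T where T: "\<And>n. fst (T n) \<in> unitary_matrices"
    "\<And>n. fst (snd (T n)) \<in> unitary_matrices" "\<And>n. snd (snd (T n)) \<in> \<Gamma>"
    "\<And>n x. x \<in> X \<Longrightarrow> \<alpha> x (s n) - \<alpha> 0 (s n) = fst (T n) ** snd (snd (T n)) x ** fst (snd (T n))"
    by blast
  define U where "U n = fst (T n)" for n
  define W where "W n = fst (snd (T n))" for n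
  define G where "G n = snd (snd (T n))" for n
  have U: "U n \<in> unitary_matrices" and W: "W n \<in> unitary_matrices" and G: "G n \<in> \<Gamma>" for n
    unfolding U_def W_def G_def by (rule T)+
  have UGW: "\<alpha> x (s n) - \<alpha> 0 (s n) = U n ** G n x ** W n" if "x \<in> X" for x n
    unfolding U_def W_def G_def by (rule T(4)[OF that])
  have "finite (range G)"
    using G test unfolding test_set_def by (meson finite_subset image_subsetI)
  then obtain m where m: "infinite {n \<in> UNIV. G n = G m}"
    using pigeonhole_infinite[of UNIV G] by auto
  define \<gamma> where "\<gamma> = G m"
  define q where "q = enumerate {n. G n = \<gamma>}"
  have q: "strict_mono q" "\<And>n. G (q n) = \<gamma>"
    using m strict_mono_enumerate[of "{n. G n = \<gamma>}"] enumerate_in_set[of "{n. G n = \<gamma>}"]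
    unfolding q_def \<gamma>_def by auto
  have "compact ((unitary_matrices :: ('f^'n^'n) set) \<times> (unitary_matrices :: ('f^'n^'n) set))"
    by (intro compact_Times compact_unitary_matrices)
  then obtain l r where l: "l \<in> (unitary_matrices :: ('f^'n^'n) set) \<times> (unitary_matrices :: ('f^'n^'n) set)"
    and r: "strict_mono r" and lim: "((\<lambda>n. (U (q n), W (q n))) \<circ> r) \<longlonglongrightarrow> l"
    using U W unfolding compact_def by (elim allE[of _ "\<lambda>n. (U (q n), W (q n))"]) auto
  define t where "t n = s (q (r n))" for n
  define u where "u = fst l"
  define w where "w = snd l"
  have ulim: "(\<lambda>n. U (q (r n))) \<longlonglongrightarrow> u" and wlim: "(\<lambda>n. W (q (r n))) \<longlonglongrightarrow> w"
    using tendsto_fst[OF lim] tendsto_snd[OF lim] unfolding u_def w_def by (simp_all add: o_def)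
  have t0: "t \<longlonglongrightarrow> 0"
    using LIMSEQ_subseq_LIMSEQ[OF s0 strict_mono_o[OF q(1) r]] unfolding t_def by (simp add: o_def)
  have t: "t n \<in> {-1..1}" "t n \<noteq> 0" for n
    unfolding t_def using s by auto
  have "continuous (at 0) (\<alpha> x)" if "x \<in> X" for x
    using \<alpha> that unfolding rigid_motion_def by (simp add: differentiable_imp_continuous_within)
  then have \<alpha>_lim: "(\<lambda>n. \<alpha> x (t n)) \<longlonglongrightarrow> x" if "x \<in> X" for x
    using \<alpha> that t0 unfolding rigid_motion_def by (metis isCont_tendsto_compose)
  have limit: "x = u ** \<gamma> x ** w" if x: "x \<in> X" for x
  proof -
    have "(\<lambda>n. U (q (r n)) ** \<gamma> x ** W (q (r n))) \<longlonglongrightarrow> u ** \<gamma> x ** w"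
      by (intro mm.tendsto tendsto_const ulim wlim)
    then have "(\<lambda>n. \<alpha> x (t n) - \<alpha> 0 (t n)) \<longlonglongrightarrow> u ** \<gamma> x ** w"
      using UGW[OF x] q(2) unfolding t_def by simp
    moreover have "(\<lambda>n. \<alpha> x (t n) - \<alpha> 0 (t n)) \<longlonglongrightarrow> x - 0"
      by (intro tendsto_diff \<alpha>_lim x zero_in)
    ultimately show ?thesis
      using LIMSEQ_unique by fastforce
  qed
  have \<gamma>: "\<gamma> \<in> \<Gamma>" unfolding \<gamma>_def by (rule G)
  then have \<gamma>_1: "\<gamma> (mat 1) = mat 1"
    using test unfolding test_set_def by blast
  have "mat 1 = u ** \<gamma> (mat 1) ** w"
    by (rule limit[OF one_in])
  then have "u ** w = mat 1"
    unfolding \<gamma>_1 by simp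
  then have wu: "w ** u = mat 1"
    using matrix_left_right_inverse by metis
  have comm: "x ** u = u ** \<gamma> x" if "x \<in> X" for x
  proof -
    have "x ** u = u ** \<gamma> x ** (w ** u)"
      by (subst limit[OF that]) (simp add: matrix_mul_assoc)
    then show ?thesis by (simp add: wu)
  qed
  then have "u \<in> twisted_commutant \<Gamma> X"
    using \<gamma> unfolding twisted_commutant_def by blast
  then obtain c where c: "u = mat c"
    using large unfolding test_large_def by blast
  have \<gamma>_id: "\<gamma> x = x" if "x \<in> X" for x
  proof -
    have "\<gamma> x = w ** (u ** \<gamma> x)"
      by (simp add: matrix_mul_assoc wu)
    also have "u ** \<gamma> x = u ** x"
      unfolding comm[OF that, symmetric] unfolding c by (rule mat_mult_commute[symmetric])
    finally show ?thesis
      by (simp add: matrix_mul_assoc wu)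
  qed
  show thesis
  proof (rule that[of t "\<lambda>n. U (q (r n))" "\<lambda>n. W (q (r n))"])
    show "\<alpha> x (t n) - \<alpha> 0 (t n) = U (q (r n)) ** x ** W (q (r n))" if "x \<in> X" for n x
      using UGW[OF that, of "q (r n)"] \<gamma>_id[OF that] q(2) unfolding t_def by simp
  qed (use t0 t U W in auto)
qed

text \<open>
  With \<open>h = u w\<close> the linear part of the motion is \<open>x \<mapsto> (u x u\<^sup>*) h\<close>. The value at the identity matrix
  shows that \<open>h\<close> has a derivative \<open>d\<close>, which is skew-hermitian because \<open>h\<close> is unitary. Dividing by \<open>h\<close>
  leaves the conjugations, whose difference quotients thus converge on \<open>X\<close>.
\<close>
theorem rigid_velocity_form:
  assumes "\<eta> \<in> rigid_velocities X N"
  obtains a d where "a \<in> skew_hermitian_matrices" "d \<in> skew_hermitian_matrices" "d \<in> X" "\<eta> 0 \<in> X"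
    "\<And>x. x \<in> X \<Longrightarrow> \<eta> x = \<eta> 0 + a ** x - x ** a + x ** d"
proof -
  obtain \<alpha> where \<alpha>: "rigid_motion X N \<alpha>" and \<eta>: "\<eta> = (\<lambda>x\<in>X. vector_derivative (\<alpha> x) (at 0))"
    using assms unfolding rigid_velocities_def by blast
  obtain t u w where t: "t \<longlonglongrightarrow> 0" "\<And>n. t n \<noteq> 0" "\<And>n. t n \<in> {-1..1}"
    and u: "\<And>n. u n \<in> unitary_matrices" and w: "\<And>n. w n \<in> unitary_matrices"
    and uw: "\<And>n x. x \<in> X \<Longrightarrow> \<alpha> x (t n) - \<alpha> 0 (t n) = u n ** x ** w n"
    using rigid_motion_unitary_sequence[OF \<alpha>] by metis
  have uu: "conj_transpose (u n) ** u n = mat 1" "u n ** conj_transpose (u n) = mat 1"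
    and ww: "w n ** conj_transpose (w n) = mat 1" "conj_transpose (w n) ** w n = mat 1" for n
    using u w unfolding unitary_matrices_def by auto
  have \<alpha>0: "\<alpha> x 0 = x" if "x \<in> X" for x
    using \<alpha> that unfolding rigid_motion_def by blast
  have \<alpha>t: "\<alpha> x (t n) \<in> X" if "x \<in> X" for x n
    using \<alpha> that t(3)[of n] unfolding rigid_motion_def by blast
  have at0: "filterlim t (at 0) sequentially"
    using t(1,2) by (simp add: filterlim_at)
  have \<alpha>': "(\<lambda>n. (1 / t n) *\<^sub>R (\<alpha> x (t n) - x)) \<longlonglongrightarrow> \<eta> x" if x: "x \<in> X" for x
  proof -
    have "(\<alpha> x has_vector_derivative \<eta> x) (at 0)"
      using \<alpha> x unfolding rigid_motion_def \<eta> by (auto simp: vector_derivative_works[symmetric])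
    then have "((\<lambda>s. (1 / s) *\<^sub>R (\<alpha> x s - \<alpha> x 0)) \<longlongrightarrow> \<eta> x) (at 0)"
      by (simp only: has_vector_derivative_iff_quotient_tendsto)
    from filterlim_compose[OF this at0] show ?thesis
      by (simp only: \<alpha>0[OF x])
  qed
  define D where "D x = \<eta> x - \<eta> 0" for x
  have D: "(\<lambda>n. (1 / t n) *\<^sub>R (u n ** x ** w n - x)) \<longlonglongrightarrow> D x" if x: "x \<in> X" for x
    using tendsto_diff[OF \<alpha>'[OF x] \<alpha>'[OF zero_in]]
    unfolding D_def by (simp add: uw[OF x, symmetric] algebra_simps)
  have in_X: "\<eta> x \<in> X" if x: "x \<in> X" for x
    by (rule closed_sequentially[OF closed_subspace[OF X] _ \<alpha>'[OF x]])
      (intro subspace_scale[OF X] subspace_diff[OF X] \<alpha>t x)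
  define h where "h n = u n ** w n" for n
  define d where "d = D (mat 1)"
  have h_quot: "(\<lambda>n. (1 / t n) *\<^sub>R (h n - mat 1)) \<longlonglongrightarrow> d"
    using D[OF one_in] unfolding h_def d_def by simp
  have "(\<lambda>n. mat 1 + t n *\<^sub>R ((1 / t n) *\<^sub>R (h n - mat 1))) \<longlonglongrightarrow> mat 1 + 0 *\<^sub>R d"
    by (intro tendsto_intros t h_quot)
  then have h_lim: "h \<longlonglongrightarrow> mat 1"
    using t(2) by simp
  have hh: "conj_transpose (h n) ** h n = mat 1" for n
    using unitary_mult[OF u w] unfolding h_def unitary_matrices_def by blast
  have hs_quot: "(\<lambda>n. (1 / t n) *\<^sub>R (conj_transpose (h n) - mat 1)) \<longlonglongrightarrow> conj_transpose d"
    using tendsto_conj_transpose[OF h_quot] by (simp add: conj_transpose_simps)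
  have "(\<lambda>n. ((1 / t n) *\<^sub>R (conj_transpose (h n) - mat 1)) ** h n + (1 / t n) *\<^sub>R (h n - mat 1))
      \<longlonglongrightarrow> conj_transpose d ** mat 1 + d"
    by (intro tendsto_add mm.tendsto hs_quot h_quot h_lim)
  moreover have "((1 / t n) *\<^sub>R (conj_transpose (h n) - mat 1)) ** h n + (1 / t n) *\<^sub>R (h n - mat 1) = 0" for n
    by (simp add: matrix_ring_simps hh scaleR_right_diff_distrib)
  ultimately have "(\<lambda>n. 0) \<longlonglongrightarrow> conj_transpose d + d"
    by simp
  from LIMSEQ_unique[OF this tendsto_const] have "conj_transpose d + d = 0" .
  then have d_skew: "conj_transpose d = - d"
    by (simp add: eq_neg_iff_add_eq_0)
  have conj: "(\<lambda>n. (1 / t n) *\<^sub>R (u n ** x ** conj_transpose (u n) - x)) \<longlonglongrightarrow> D x - x ** d"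
    if x: "x \<in> X" for x
  proof -
    have "u n ** x ** conj_transpose (u n) = u n ** x ** w n ** conj_transpose (h n)" for n
    proof -
      have "u n ** x ** w n ** conj_transpose (h n)
          = u n ** x ** (w n ** conj_transpose (w n)) ** conj_transpose (u n)"
        unfolding h_def conj_transpose_mult by (simp only: matrix_mul_assoc)
      then show ?thesis by (simp add: ww)
    qed
    then have "(1 / t n) *\<^sub>R (u n ** x ** conj_transpose (u n) - x) =
        ((1 / t n) *\<^sub>R (u n ** x ** w n - x)) ** conj_transpose (h n)
        + x ** ((1 / t n) *\<^sub>R (conj_transpose (h n) - mat 1))" for n
      by (simp add: matrix_ring_simps scaleR_right_diff_distrib)
    moreover have "(\<lambda>n. ((1 / t n) *\<^sub>R (u n ** x ** w n - x)) ** conj_transpose (h n)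
        + x ** ((1 / t n) *\<^sub>R (conj_transpose (h n) - mat 1)))
        \<longlonglongrightarrow> D x ** conj_transpose (mat 1) + x ** conj_transpose d"
      by (intro tendsto_add mm.tendsto tendsto_const hs_quot D[OF x] tendsto_conj_transpose h_lim)
    ultimately show ?thesis
      by (simp add: d_skew mm.minus_right)
  qed
  have "convergent (\<lambda>n. (1 / t n) *\<^sub>R (u n ** x ** conj_transpose (u n) - x))"
    if "x \<in> hermitian_matrices" for x
    using conj that hermitian unfolding convergent_def by blast
  then obtain a where a: "a \<in> skew_hermitian_matrices"
    "\<And>x. (\<lambda>n. (1 / t n) *\<^sub>R (u n ** x ** conj_transpose (u n) - x)) \<longlonglongrightarrow> a ** x - x ** a"
    using unitary_conjugations_derivative[where u = u, OF u t(1,2)] by blast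
  have "\<eta> x = \<eta> 0 + a ** x - x ** a + x ** d" if x: "x \<in> X" for x
  proof -
    have "a ** x - x ** a = D x - x ** d"
      using LIMSEQ_unique[OF a(2) conj[OF x]] .
    then show ?thesis unfolding D_def by (simp add: algebra_simps)
  qed
  moreover have "d \<in> X"
    unfolding d_def D_def by (intro subspace_diff[OF X] in_X one_in zero_in)
  ultimately show thesis
    using that[of a d] a(1) d_skew in_X[OF zero_in] unfolding skew_hermitian_matrices_def by blast
qed

lemma unitary_paths_rigid_velocity:
  assumes c: "c \<in> X"
    and u: "\<And>t. u t \<in> unitary_matrices" "u 0 = mat 1" "continuous_on UNIV u" "(u has_vector_derivative a) (at 0)"
    and w: "\<And>t. w t \<in> unitary_matrices" "w 0 = mat 1" "continuous_on UNIV w" "(w has_vector_derivative b) (at 0)"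
    and maps: "\<And>t x. x \<in> X \<Longrightarrow> u t ** x ** w t \<in> X"
  shows "(\<lambda>x\<in>X. c + a ** x + x ** b) \<in> rigid_velocities X N"
proof -
  define \<alpha> where "\<alpha> x t = t *\<^sub>R c + u t ** x ** w t" for x t
  have \<alpha>': "(\<alpha> x has_vector_derivative c + a ** x + x ** b) (at 0)" for x
  proof -
    have "((\<lambda>t. u t ** x ** w t) has_vector_derivative (u 0 ** x ** b + (u 0 ** 0 + a ** x) ** w 0)) (at 0)"
      by (intro mm.has_vector_derivative u(4) w(4) has_vector_derivative_const)
    then have "((\<lambda>t. u t ** x ** w t) has_vector_derivative (a ** x + x ** b)) (at 0)"
      by (simp add: u(2) w(2) mm.zero_right add.commute)
    moreover have "((\<lambda>t. t *\<^sub>R c) has_vector_derivative c) (at 0)"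
      by (auto intro!: derivative_eq_intros)
    ultimately have "(\<alpha> x has_vector_derivative c + (a ** x + x ** b)) (at 0)"
      unfolding \<alpha>_def by (rule has_vector_derivative_add[rotated])
    then show ?thesis by (simp add: add.assoc)
  qed
  have "rigid_motion X N \<alpha>"
    unfolding rigid_motion_def
  proof (intro conjI ballI)
    fix x assume x: "x \<in> X"
    have "continuous_on UNIV (\<alpha> x)"
      unfolding \<alpha>_def by (intro continuous_intros mm.continuous_on u(3) w(3))
    then show "continuous_on {-1..1} (\<alpha> x)"
      by (rule continuous_on_subset) simp
    show "\<alpha> x ` {-1..1} \<subseteq> X"
      unfolding \<alpha>_def by (auto intro!: subspace_add[OF X] subspace_scale[OF X] c maps x)
    show "\<alpha> x 0 = x"
      unfolding \<alpha>_def by (simp add: u(2) w(2))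
    show "\<alpha> x differentiable at 0"
      using \<alpha>' by (rule differentiableI_vector)
    fix y t
    have "\<alpha> x t - \<alpha> y t = u t ** (x - y) ** w t"
      unfolding \<alpha>_def by (simp add: matrix_ring_simps)
    then show "N (\<alpha> x t - \<alpha> y t) = N (x - y)"
      using invariant u(1) w(1) unfolding unitarily_invariant_def by simp
  qed
  moreover have "(\<lambda>x\<in>X. c + a ** x + x ** b) = (\<lambda>x\<in>X. vector_derivative (\<alpha> x) (at 0))"
    unfolding vector_derivative_at[OF \<alpha>'] ..
  ultimately show ?thesis
    unfolding rigid_velocities_def by blast
qed

end

lemma admissible_unitary_matrix_space:
  assumes "admissible_matrix_space one X N" "hermitian_matrices \<subseteq> X"
  obtains \<Gamma> where "unitary_matrix_space X N \<Gamma>"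
  using assms unfolding admissible_matrix_space_def unitary_matrix_space_def by blast

text \<open>
  A complement of the skew-hermitian scalar matrices. Scalar matrices are the only parameters that
  do not affect the velocity, so normalising one diagonal entry makes the parameters unique.
\<close>
definition skew_zero_entry :: "'n \<Rightarrow> ('f::real_or_complex^'n^'n) set"
  where "skew_zero_entry k = {a \<in> skew_hermitian_matrices. a $ k $ k = 0}"

lemma subspace_skew_zero_entry: "subspace (skew_zero_entry k)"
  using subspace_skew_hermitian unfolding skew_zero_entry_def subspace_def by auto

lemma skew_hermitian_scalar_part:
  assumes "a \<in> skew_hermitian_matrices"
  shows "mat (a $ k $ k) \<in> skew_hermitian_matrices" "a - mat (a $ k $ k) \<in> skew_zero_entry k"
proof -
  show *: "mat (a $ k $ k) \<in> skew_hermitian_matrices"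
    using skew_hermitianD[OF assms] unfolding skew_hermitian_matrices_def
    by (simp add: conj_transpose_mat vec_eq_iff mat_def)
  then show "a - mat (a $ k $ k) \<in> skew_zero_entry k"
    unfolding skew_zero_entry_def using subspace_diff[OF subspace_skew_hermitian assms]
    by (simp add: mat_def)
qed

lemma (in unitary_matrix_space) commuting_zero_entry_eq_0:
  assumes "b \<in> skew_zero_entry k" "\<And>x. x \<in> X \<Longrightarrow> x ** b = b ** x"
  shows "b = 0"
proof -
  obtain c where c: "b = mat c"
    using commutant_scalar[OF assms(2)] .
  moreover have "b $ k $ k = 0"
    using assms(1) unfolding skew_zero_entry_def by blast
  ultimately have "c = 0" by (simp add: mat_def)
  then show ?thesis by (simp add: c)
qed

lemma (in unitary_matrix_space) parametrised_UNIV: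
  assumes UNIV: "X = UNIV"
  shows "parametrised_rigid_velocities X N
    (UNIV \<times> skew_hermitian_matrices \<times> skew_zero_entry k)
    (\<lambda>q x. fst q + fst (snd q) ** x + x ** snd (snd q))"
    (is "parametrised_rigid_velocities X N ?P ?F")
proof (rule parametrised_rigid_velocities.intro)
  show "subspace ?P"
    by (intro subspace_Times subspace_UNIV subspace_skew_hermitian subspace_skew_zero_entry)
  show "linear (\<lambda>q. ?F q x)" for x
    by (rule linearI) (simp_all add: matrix_ring_simps algebra_simps)
  show "rigid_velocities X N = (\<lambda>q. \<lambda>x\<in>X. ?F q x) ` ?P"
  proof (intro equalityI subsetI)
    fix \<eta> assume \<eta>: "\<eta> \<in> rigid_velocities X N"
    obtain a d where ad: "a \<in> skew_hermitian_matrices" "d \<in> skew_hermitian_matrices"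
      "\<And>x. x \<in> X \<Longrightarrow> \<eta> x = \<eta> 0 + a ** x - x ** a + x ** d"
      using rigid_velocity_form[OF \<eta>] by metis
    \<comment> \<open>scalar matrices commute with \<open>x\<close>, so \<open>s\<close> can be moved from the right factor to the left one\<close>
    define s :: "'f^'n^'n" where "s = mat ((d - a) $ k $ k)"
    have da: "d - a \<in> skew_hermitian_matrices"
      by (intro subspace_diff[OF subspace_skew_hermitian] ad)
    have P: "(\<eta> 0, a + s, (d - a) - s) \<in> ?P"
      using skew_hermitian_scalar_part[OF da, of k] subspace_add[OF subspace_skew_hermitian ad(1)]
      unfolding s_def by simp
    have comm: "s ** x = x ** s" for x
      unfolding s_def by (rule mat_mult_commute)
    have "\<eta> = (\<lambda>x\<in>X. ?F (\<eta> 0, a + s, (d - a) - s) x)"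
    proof
      fix x
      show "\<eta> x = (\<lambda>x\<in>X. ?F (\<eta> 0, a + s, (d - a) - s) x) x"
        using ad(3)[of x] by (simp add: UNIV matrix_ring_simps comm)
    qed
    with P show "\<eta> \<in> (\<lambda>q. \<lambda>x\<in>X. ?F q x) ` ?P" by blast
  next
    fix \<eta> assume "\<eta> \<in> (\<lambda>q. \<lambda>x\<in>X. ?F q x) ` ?P"
    then obtain c a b where ab: "a \<in> skew_hermitian_matrices" "b \<in> skew_hermitian_matrices"
      and \<eta>: "\<eta> = (\<lambda>x\<in>X. c + a ** x + x ** b)"
      unfolding skew_zero_entry_def by auto
    obtain u where u: "\<And>t. u t \<in> unitary_matrices" "u 0 = mat 1" "continuous_on UNIV u"
      "(u has_vector_derivative a) (at 0)"
      using skew_hermitian_unitary_path[OF ab(1)] by metis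
    obtain w where w: "\<And>t. w t \<in> unitary_matrices" "w 0 = mat 1" "continuous_on UNIV w"
      "(w has_vector_derivative b) (at 0)"
      using skew_hermitian_unitary_path[OF ab(2)] by metis
    show "\<eta> \<in> rigid_velocities X N"
      unfolding \<eta> by (rule unitary_paths_rigid_velocity[OF _ u w]) (simp_all add: UNIV)
  qed
  fix q assume q: "q \<in> ?P" and 0: "\<And>x. x \<in> X \<Longrightarrow> ?F q x = 0"
  obtain c a b where cab: "q = (c, a, b)" by (metis surj_pair)
  have c: "c = 0" using 0[OF zero_in] by (simp add: cab)
  have ab: "a = - b" using 0[OF one_in] by (simp add: cab c eq_neg_iff_add_eq_0)
  have "b = 0"
  proof (rule commuting_zero_entry_eq_0)
    show "b \<in> skew_zero_entry k" using q by (simp add: cab)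
    show "x ** b = b ** x" if "x \<in> X" for x
      using 0[OF that] by (simp add: cab c ab mm.minus_left)
  qed
  then show "q = 0" by (simp add: cab c ab zero_prod_def)
qed (use X N UNIV in auto)

lemma (in unitary_matrix_space) parametrised_hermitian:
  assumes H: "X = hermitian_matrices"
  shows "parametrised_rigid_velocities X N
    (hermitian_matrices \<times> skew_zero_entry k) (\<lambda>q x. fst q + snd q ** x - x ** snd q)"
    (is "parametrised_rigid_velocities X N ?P ?F")
proof (rule parametrised_rigid_velocities.intro)
  show "subspace ?P"
    by (intro subspace_Times subspace_hermitian subspace_skew_zero_entry)
  show "linear (\<lambda>q. ?F q x)" for x
    by (rule linearI) (simp_all add: matrix_ring_simps algebra_simps)
  show "rigid_velocities X N = (\<lambda>q. \<lambda>x\<in>X. ?F q x) ` ?P"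
  proof (intro equalityI subsetI)
    fix \<eta> assume \<eta>: "\<eta> \<in> rigid_velocities X N"
    obtain a d where ad: "a \<in> skew_hermitian_matrices" "d \<in> skew_hermitian_matrices" "d \<in> X" "\<eta> 0 \<in> X"
      "\<And>x. x \<in> X \<Longrightarrow> \<eta> x = \<eta> 0 + a ** x - x ** a + x ** d"
      using rigid_velocity_form[OF \<eta>] by metis
    \<comment> \<open>\<open>d\<close> is both hermitian and skew-hermitian\<close>
    have "d = - d"
      using ad(2,3) unfolding H hermitian_matrices_def skew_hermitian_matrices_def by simp
    then have "2 *\<^sub>R d = 0" by (metis add.right_inverse scaleR_2)
    then have d: "d = 0" by simp
    \<comment> \<open>subtracting a scalar matrix does not change the commutator with \<open>a\<close>\<close>
    define s :: "'f^'n^'n" where "s = mat (a $ k $ k)"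
    have P: "(\<eta> 0, a - s) \<in> ?P"
      using skew_hermitian_scalar_part(2)[OF ad(1)] ad(4) unfolding s_def H by simp
    have comm: "s ** x = x ** s" for x
      unfolding s_def by (rule mat_mult_commute)
    have ext: "\<eta> x = undefined" if "x \<notin> X" for x
      using \<eta> that unfolding rigid_velocities_def by auto
    have "\<eta> = (\<lambda>x\<in>X. ?F (\<eta> 0, a - s) x)"
    proof
      fix x
      show "\<eta> x = (\<lambda>x\<in>X. ?F (\<eta> 0, a - s) x) x"
        using ad(5)[of x] ext[of x] by (simp add: d matrix_ring_simps comm)
    qed
    with P show "\<eta> \<in> (\<lambda>q. \<lambda>x\<in>X. ?F q x) ` ?P" by blast
  next
    fix \<eta> assume "\<eta> \<in> (\<lambda>q. \<lambda>x\<in>X. ?F q x) ` ?P"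
    then obtain c a where c: "c \<in> X" and a: "a \<in> skew_hermitian_matrices"
      and \<eta>: "\<eta> = (\<lambda>x\<in>X. c + a ** x - x ** a)"
      unfolding skew_zero_entry_def H by auto
    obtain u where u: "\<And>t. u t \<in> unitary_matrices" "u 0 = mat 1" "continuous_on UNIV u"
      "(u has_vector_derivative a) (at 0)"
      using skew_hermitian_unitary_path[OF a] by metis
    define w where "w t = conj_transpose (u t)" for t
    have "bounded_linear (conj_transpose :: 'f^'n^'n \<Rightarrow> 'f^'n^'n)"
      using linear_conj_transpose by (simp add: linear_conv_bounded_linear)
    from bounded_linear.has_vector_derivative[OF this u(4)]
    have "(w has_vector_derivative - a) (at 0)"
      using a unfolding w_def skew_hermitian_matrices_def by simp
    moreover have "continuous_on UNIV w"
      unfolding w_def by (intro continuous_intros u(3))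
    moreover have "w t \<in> unitary_matrices" for t
      unfolding w_def by (rule unitary_conj_transpose[OF u(1)])
    moreover have "w 0 = mat 1"
      unfolding w_def u(2) by simp
    moreover have "u t ** x ** w t \<in> X" if "x \<in> X" for t x
      using that unfolding H hermitian_matrices_def w_def
      by (simp add: conj_transpose_mult matrix_mul_assoc)
    ultimately have "(\<lambda>x\<in>X. c + a ** x + x ** (- a)) \<in> rigid_velocities X N"
      by (intro unitary_paths_rigid_velocity[OF c u])
    then show "\<eta> \<in> rigid_velocities X N"
      unfolding \<eta> by (simp add: mm.minus_right)
  qed
  show "?F q x \<in> X" if "q \<in> ?P" "x \<in> X" for q x
    using that unfolding H hermitian_matrices_def skew_zero_entry_def skew_hermitian_matrices_def
    by (auto simp: conj_transpose_simps conj_transpose_mult mm.minus_left mm.minus_right)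
  fix q assume q: "q \<in> ?P" and 0: "\<And>x. x \<in> X \<Longrightarrow> ?F q x = 0"
  obtain c a where ca: "q = (c, a)" by (metis surj_pair)
  have c: "c = 0" using 0[OF zero_in] by (simp add: ca)
  have "a = 0"
  proof (rule commuting_zero_entry_eq_0)
    show "a \<in> skew_zero_entry k" using q by (simp add: ca)
    show "x ** a = a ** x" if "x \<in> X" for x
      using 0[OF that] by (simp add: ca c)
  qed
  then show "q = 0" by (simp add: ca c zero_prod_def)
qed (use X N in auto)

section \<open>Dimensions of spaces of matrices\<close>

text \<open>
  The map \<open>x \<mapsto> x + x\<^sup>*\<close> has the skew-hermitian matrices as kernel and the hermitian ones as image.
\<close>
lemma dim_skew_plus_dim_hermitian:
  "dim (skew_hermitian_matrices :: ('f::real_or_complex^'n^'n) set)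
    + dim (hermitian_matrices :: ('f^'n^'n) set) = CARD('n) * CARD('n) * DIM('f)"
proof -
  define f :: "'f^'n^'n \<Rightarrow> 'f^'n^'n" where "f x = x + conj_transpose x" for x
  have f: "linear f"
    unfolding f_def by (intro linearI) (simp_all add: conj_transpose_simps scaleR_add_right)
  have "{x \<in> UNIV. f x = 0} = skew_hermitian_matrices"
    unfolding f_def skew_hermitian_matrices_def
    by (auto simp: add_eq_0_iff)
  moreover have "f ` UNIV = hermitian_matrices"
  proof (intro equalityI subsetI)
    fix x :: "'f^'n^'n" assume "x \<in> hermitian_matrices"
    then have "x = f ((1/2) *\<^sub>R x)"
      unfolding f_def hermitian_matrices_def by (simp add: conj_transpose_simps flip: scaleR_2 scaleR_add_right)
    then show "x \<in> f ` UNIV" by blast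
  qed (auto simp: f_def hermitian_matrices_def conj_transpose_simps add.commute)
  ultimately show ?thesis
    using rank_nullity[OF f subspace_UNIV] by (simp add: mult.assoc)
qed

text \<open>
  Multiplication by the imaginary unit exchanges hermitian and skew-hermitian matrices.
\<close>
lemma dim_hermitian_eq_skew_complex:
  "dim (hermitian_matrices :: (complex^'n^'n) set) = dim (skew_hermitian_matrices :: (complex^'n^'n) set)"
proof -
  define f :: "complex^'n^'n \<Rightarrow> complex^'n^'n" where "f x = mat \<i> ** x" for x
  have f: "linear f"
    unfolding f_def by (intro linearI) (simp_all add: matrix_ring_simps)
  have ct: "conj_transpose (f x) = - f (conj_transpose x)" for x
    unfolding f_def by (simp add: vec_eq_iff mat_mult_nth)
  have ff: "f (f x) = - x" for x
    unfolding f_def by (simp add: vec_eq_iff mat_mult_nth flip: mult.assoc)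
  have fn: "f (- x) = - f x" for x
    by (rule linear_neg[OF f])
  have "f ` hermitian_matrices = skew_hermitian_matrices"
  proof (intro equalityI subsetI)
    fix x :: "complex^'n^'n" assume x: "x \<in> skew_hermitian_matrices"
    then have "- f x \<in> hermitian_matrices"
      unfolding skew_hermitian_matrices_def hermitian_matrices_def
      by (simp add: conj_transpose_simps ct fn)
    moreover have "x = f (- f x)" by (simp add: ff fn)
    ultimately show "x \<in> f ` hermitian_matrices" by blast
  qed (auto simp: skew_hermitian_matrices_def hermitian_matrices_def ct)
  moreover have "x = 0" if "f x = 0" for x
    using ff[of x] that linear_0[OF f] by simp
  ultimately show ?thesis
    using dim_linear_image_inj[OF f subspace_hermitian] by simp
qed

text \<open>
  The diagonal entries of skew-hermitian matrices are the purely imaginary numbers.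
\<close>
lemma dim_skew_zero_entry_complex:
  "dim (skew_hermitian_matrices :: (complex^'n^'n) set) = dim (skew_zero_entry k :: (complex^'n^'n) set) + 1"
proof -
  have lin: "linear (\<lambda>a :: complex^'n^'n. a $ k $ k)"
    by (rule linearI) simp_all
  have "(\<lambda>a :: complex^'n^'n. a $ k $ k) ` skew_hermitian_matrices = span {\<i>}"
  proof (intro equalityI subsetI)
    fix z assume "z \<in> (\<lambda>a :: complex^'n^'n. a $ k $ k) ` skew_hermitian_matrices"
    then have "cnj z = - z" using skew_hermitianD by fastforce
    then have "z = Im z *\<^sub>R \<i>" by (simp add: complex_eq_iff)
    then show "z \<in> span {\<i>}" by (metis span_base span_scale singletonI)
  next
    fix z assume "z \<in> span {\<i>}"
    then obtain r where z: "z = r *\<^sub>R \<i>" by (auto simp: span_singleton)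
    then have "mat z \<in> (skew_hermitian_matrices :: (complex^'n^'n) set)"
      unfolding skew_hermitian_matrices_def by (simp add: conj_transpose_mat vec_eq_iff mat_def)
    then show "z \<in> (\<lambda>a :: complex^'n^'n. a $ k $ k) ` skew_hermitian_matrices"
      by (rule rev_image_eqI) (simp add: mat_def)
  qed
  then show ?thesis
    using rank_nullity[OF lin subspace_skew_hermitian] unfolding skew_zero_entry_def by simp
qed

lemma skew_zero_entry_real: "skew_zero_entry k = (skew_hermitian_matrices :: (real^'n^'n) set)"
proof -
  have "a $ k $ k = 0" if "a \<in> skew_hermitian_matrices" for a :: "real^'n^'n"
    using skew_hermitianD[OF that, of k k] by simp
  then show ?thesis unfolding skew_zero_entry_def by blast
qed

text \<open>
  Taking the diagonal reduces the claim to symmetric matrices with zero diagonal. Number the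
  indices and change the sign of the entries below the diagonal: this exchanges them with the
  skew-symmetric matrices.
\<close>
lemma dim_hermitian_real:
  "dim (hermitian_matrices :: (real^'n^'n) set)
    = dim (skew_hermitian_matrices :: (real^'n^'n) set) + CARD('n)"
proof -
  define diag :: "real^'n^'n \<Rightarrow> real^'n" where "diag a = (\<chi> i. a $ i $ i)" for a
  have diag: "linear diag"
    unfolding diag_def by (rule linearI) (simp_all add: vec_eq_iff)
  have herm: "a \<in> hermitian_matrices \<longleftrightarrow> (\<forall>i j. a $ j $ i = a $ i $ j)" for a :: "real^'n^'n"
    unfolding hermitian_matrices_def by (simp add: vec_eq_iff)
  have skew: "a \<in> skew_hermitian_matrices \<longleftrightarrow> (\<forall>i j. a $ j $ i = - a $ i $ j)" for a :: "real^'n^'n"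
    unfolding skew_hermitian_matrices_def by (simp add: vec_eq_iff)
  have "diag ` hermitian_matrices = UNIV"
  proof (intro equalityI subsetI)
    fix v :: "real^'n"
    have "(\<chi> i j. if i = j then v $ i else 0) \<in> hermitian_matrices" by (auto simp: herm)
    then show "v \<in> diag ` hermitian_matrices"
      by (rule rev_image_eqI) (simp add: diag_def vec_eq_iff)
  qed simp
  then have 1: "dim (hermitian_matrices :: (real^'n^'n) set)
      = dim {a \<in> hermitian_matrices. diag a = 0} + CARD('n)"
    using rank_nullity[OF diag subspace_hermitian] by simp
  obtain f :: "'n \<Rightarrow> nat" where f: "inj f"
    using finite_imp_inj_to_nat_seg[of "UNIV :: 'n set"] by auto
  define \<sigma> :: "'n \<Rightarrow> 'n \<Rightarrow> real" where "\<sigma> i j = (if f i < f j then 1 else -1)" for i j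
  have \<sigma>: "\<sigma> i j * \<sigma> i j = 1" "i \<noteq> j \<Longrightarrow> \<sigma> j i = - \<sigma> i j" for i j
    using f unfolding \<sigma>_def by (auto dest: injD)
  define S :: "real^'n^'n \<Rightarrow> real^'n^'n" where "S a = (\<chi> i j. \<sigma> i j * a $ i $ j)" for a
  have S: "linear S"
    unfolding S_def by (rule linearI) (simp_all add: vec_eq_iff algebra_simps)
  have SS: "S (S a) = a" for a
    unfolding S_def by (simp add: vec_eq_iff \<sigma>(1) flip: mult.assoc)
  have "S ` skew_hermitian_matrices = {a \<in> hermitian_matrices. diag a = 0}"
  proof (intro equalityI subsetI)
    fix b assume "b \<in> S ` skew_hermitian_matrices"
    then obtain a where "a \<in> skew_hermitian_matrices" and b: "b = S a"
      by blast
    then have a: "a $ j $ i = - a $ i $ j" for i j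
      unfolding skew by blast
    have d: "a $ i $ i = 0" for i using a[of i i] by simp
    have "b $ j $ i = b $ i $ j" for i j
      using \<sigma>(2)[of i j] a[of i j] unfolding b S_def by (cases "i = j") simp_all
    then show "b \<in> {a \<in> hermitian_matrices. diag a = 0}"
      using d unfolding herm by (simp add: diag_def vec_eq_iff b S_def)
  next
    fix b :: "real^'n^'n" assume "b \<in> {a \<in> hermitian_matrices. diag a = 0}"
    then have b: "b $ j $ i = b $ i $ j" "b $ i $ i = 0" for i j
      unfolding herm by (simp_all add: diag_def vec_eq_iff)
    have "S b $ j $ i = - S b $ i $ j" for i j
      using \<sigma>(2)[of i j] b(1)[of i j] b(2) unfolding S_def by (cases "i = j") simp_all
    then have "S b \<in> skew_hermitian_matrices" unfolding skew by blast
    then show "b \<in> S ` skew_hermitian_matrices" using SS by (metis image_eqI)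
  qed
  moreover have "a = 0" if "S a = 0" for a
    using SS[of a] that linear_0[OF S] by simp
  ultimately have "dim {a \<in> (hermitian_matrices :: (real^'n^'n) set). diag a = 0}
      = dim (skew_hermitian_matrices :: (real^'n^'n) set)"
    using dim_linear_image_inj[OF S subspace_skew_hermitian] by simp
  with 1 show ?thesis by simp
qed

lemma skew_dimensions_real:
  assumes "n = int CARD('n)"
  shows "2 * int (dim (skew_hermitian_matrices :: (real^'n^'n) set)) = n\<^sup>2 - n"
    "int (dim (hermitian_matrices :: (real^'n^'n) set)) = n * (n + 1) div 2"
proof -
  define s where "s = int (dim (skew_hermitian_matrices :: (real^'n^'n) set))"
  have h: "int (dim (hermitian_matrices :: (real^'n^'n) set)) = s + n"
    unfolding s_def assms by (simp add: dim_hermitian_real)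
  have "s + int (dim (hermitian_matrices :: (real^'n^'n) set)) = n * n"
    unfolding s_def assms
    by (simp add: dim_skew_plus_dim_hermitian[where 'f = real] flip: of_nat_add of_nat_mult)
  then have s: "2 * s = n\<^sup>2 - n"
    unfolding h by (simp add: power2_eq_square)
  then show "2 * int (dim (skew_hermitian_matrices :: (real^'n^'n) set)) = n\<^sup>2 - n"
    unfolding s_def .
  have "n * (n + 1) = 2 * (s + n)"
    using s by (simp add: power2_eq_square algebra_simps)
  then show "int (dim (hermitian_matrices :: (real^'n^'n) set)) = n * (n + 1) div 2"
    unfolding h by simp
qed

lemma skew_dimensions_complex:
  assumes "n = int CARD('n)"
  shows "int (dim (skew_hermitian_matrices :: (complex^'n^'n) set)) = n\<^sup>2"
    "int (dim (hermitian_matrices :: (complex^'n^'n) set)) = n\<^sup>2"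
    "int (dim (skew_zero_entry k :: (complex^'n^'n) set)) = n\<^sup>2 - 1"
proof -
  have "int (dim (skew_hermitian_matrices :: (complex^'n^'n) set))
      + int (dim (hermitian_matrices :: (complex^'n^'n) set)) = n * n * 2"
    unfolding assms
    by (simp add: dim_skew_plus_dim_hermitian[where 'f = complex] flip: of_nat_add of_nat_mult)
  then show s: "int (dim (skew_hermitian_matrices :: (complex^'n^'n) set)) = n\<^sup>2"
    and "int (dim (hermitian_matrices :: (complex^'n^'n) set)) = n\<^sup>2"
    by (simp_all add: dim_hermitian_eq_skew_complex power2_eq_square)
  show "int (dim (skew_zero_entry k :: (complex^'n^'n) set)) = n\<^sup>2 - 1"
    using s dim_skew_zero_entry_complex[of k] by simp
qed

section \<open>The counts for the four matrix spaces\<close>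

text \<open>
  The conclusion of the main theorem for one space, as a function of \<open>k\<close> and \<open>l\<close>.
\<close>
definition sparsity_counts ::
    "'a::euclidean_space set \<Rightarrow> ('a \<Rightarrow> real) \<Rightarrow> 'v set \<Rightarrow> 'v set set \<Rightarrow> ('v \<Rightarrow> 'a) \<Rightarrow> int \<Rightarrow> int \<Rightarrow> bool"
  where "sparsity_counts X N V E p k l \<longleftrightarrow>
    (infinitesimally_rigid X N V E p \<longrightarrow> int (card E) \<ge> k * int (card V) - l) \<and>
    (minimally_infinitesimally_rigid X N V E p \<longrightarrow> int (card E) = k * int (card V) - l) \<and>
    (minimally_infinitesimally_rigid X N V E p \<longrightarrow>
      (\<forall>VH EH. is_subgraph VH EH V E \<and> full_framework X N VH (restrict p VH) \<longrightarrow>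
        int (card EH) \<le> k * int (card VH) - l))"

lemma (in parametrised_rigid_velocities) sparsity_counts_parametrised:
  assumes "finite_simple_graph V E" "framework X V E p" "full_framework X N V p"
    "well_positioned X N E p" and "k = int (dim X)" "l = int (dim P)"
  shows "sparsity_counts X N V E p k l"
  unfolding sparsity_counts_def assms(5,6) using rigidity_counts[OF assms(1-4)] by blast

lemma sparsity_counts_UNIV:
  fixes N :: "'f::real_or_complex^'n^'n \<Rightarrow> real"
  assumes "admissible_matrix_space one UNIV N" "finite_simple_graph V E" "framework UNIV V E p"
    "full_framework UNIV N V p" "well_positioned UNIV N E p"
    and "l = k + int (dim (skew_hermitian_matrices :: ('f^'n^'n) set))
      + int (dim (skew_zero_entry one :: ('f^'n^'n) set))"
    and "k = int (CARD('n) * CARD('n) * DIM('f))"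
  shows "sparsity_counts UNIV N V E p k l"
proof -
  obtain \<Gamma> where "unitary_matrix_space UNIV N \<Gamma>"
    using admissible_unitary_matrix_space[OF assms(1)] by blast
  then interpret unitary_matrix_space UNIV N \<Gamma> .
  interpret parametrised_rigid_velocities UNIV N
    "UNIV \<times> skew_hermitian_matrices \<times> skew_zero_entry one"
    "\<lambda>q x. fst q + fst (snd q) ** x + x ** snd (snd q)"
    by (rule parametrised_UNIV[OF refl])
  show ?thesis
    using assms by (intro sparsity_counts_parametrised)
      (simp_all add: dim_Times subspace_Times subspace_skew_hermitian subspace_skew_zero_entry mult.assoc)
qed

lemma sparsity_counts_hermitian:
  fixes N :: "'f::real_or_complex^'n^'n \<Rightarrow> real"
  assumes "admissible_matrix_space one hermitian_matrices N" "finite_simple_graph V E"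
    "framework hermitian_matrices V E p" "full_framework hermitian_matrices N V p"
    "well_positioned hermitian_matrices N E p"
    and "l = k + int (dim (skew_zero_entry one :: ('f^'n^'n) set))"
    and "k = int (dim (hermitian_matrices :: ('f^'n^'n) set))"
  shows "sparsity_counts hermitian_matrices N V E p k l"
proof -
  obtain \<Gamma> where "unitary_matrix_space hermitian_matrices N \<Gamma>"
    using admissible_unitary_matrix_space[OF assms(1)] by blast
  then interpret unitary_matrix_space hermitian_matrices N \<Gamma> .
  interpret parametrised_rigid_velocities hermitian_matrices N
    "hermitian_matrices \<times> skew_zero_entry one" "\<lambda>q x. fst q + snd q ** x - x ** snd q"
    by (rule parametrised_hermitian[OF refl])
  show ?thesis
    using assms by (intro sparsity_counts_parametrised)
      (simp_all add: dim_Times subspace_hermitian subspace_skew_zero_entry)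
qed

theorem theorem3p14:
  fixes n :: int and one :: "'n::finite" and V :: "'v set" and E :: "'v set set"
  assumes "n = int CARD('n)" and "n \<ge> 2"
    and "finite_simple_graph V E"
  shows "
    (\<forall>(X :: (real^'n^'n) set) N p k l.
       (X, k, l) \<in> {(UNIV, n^2, 2 * n^2 - n),
                     (hermitian_matrices, n * (n + 1) div 2, n^2)} \<longrightarrow>
       admissible_matrix_space one X N \<longrightarrow>
       framework X V E p \<longrightarrow> full_framework X N V p \<longrightarrow> well_positioned X N E p \<longrightarrow>
         (infinitesimally_rigid X N V E p \<longrightarrow>
            int (card E) \<ge> k * int (card V) - l) \<and>
         (minimally_infinitesimally_rigid X N V E p \<longrightarrow>
            int (card E) = k * int (card V) - l) \<and>
         (minimally_infinitesimally_rigid X N V E p \<longrightarrow>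
            (\<forall>VH EH. is_subgraph VH EH V E \<and> full_framework X N VH (restrict p VH) \<longrightarrow>
               int (card EH) \<le> k * int (card VH) - l))) \<and>
    (\<forall>(X :: (complex^'n^'n) set) N p k l.
       (X, k, l) \<in> {(UNIV, 2 * n^2, 4 * n^2 - 1),
                     (hermitian_matrices, n^2, 2 * n^2 - 1)} \<longrightarrow>
       admissible_matrix_space one X N \<longrightarrow>
       framework X V E p \<longrightarrow> full_framework X N V p \<longrightarrow> well_positioned X N E p \<longrightarrow>
         (infinitesimally_rigid X N V E p \<longrightarrow>
            int (card E) \<ge> k * int (card V) - l) \<and>
         (minimally_infinitesimally_rigid X N V E p \<longrightarrow>
            int (card E) = k * int (card V) - l) \<and>
         (minimally_infinitesimally_rigid X N V E p \<longrightarrow>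
            (\<forall>VH EH. is_subgraph VH EH V E \<and> full_framework X N VH (restrict p VH) \<longrightarrow>
               int (card EH) \<le> k * int (card VH) - l)))"
proof (fold sparsity_counts_def, intro conjI allI impI)
  have n: "n\<^sup>2 = int (CARD('n) * CARD('n))"
    using assms(1) by (simp add: power2_eq_square)
  fix X :: "(real^'n^'n) set" and N p k l
  assume Xkl: "(X, k, l) \<in> {(UNIV, n^2, 2 * n^2 - n), (hermitian_matrices, n * (n + 1) div 2, n^2)}"
    and adm: "admissible_matrix_space one X N" and fw: "framework X V E p"
    and full: "full_framework X N V p" and wp: "well_positioned X N E p"
  have "n * (n + 1) div 2 + int (dim (skew_hermitian_matrices :: (real^'n^'n) set)) = n\<^sup>2"
    using skew_dimensions_real(1)[OF assms(1)] dim_hermitian_real[where 'n = 'n]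
      skew_dimensions_real(2)[OF assms(1)] assms(1) by simp
  with Xkl show "sparsity_counts X N V E p k l"
    using sparsity_counts_UNIV[OF _ assms(3), of one N p l k]
      sparsity_counts_hermitian[OF _ assms(3), of one N p l k] adm fw full wp
      skew_dimensions_real[OF assms(1)] n
    by (auto simp: skew_zero_entry_real)
next
  have n: "2 * n\<^sup>2 = int (CARD('n) * CARD('n) * DIM(complex))"
    using assms(1) by (simp add: power2_eq_square)
  fix X :: "(complex^'n^'n) set" and N p k l
  assume Xkl: "(X, k, l) \<in> {(UNIV, 2 * n^2, 4 * n^2 - 1), (hermitian_matrices, n^2, 2 * n^2 - 1)}"
    and adm: "admissible_matrix_space one X N" and fw: "framework X V E p"
    and full: "full_framework X N V p" and wp: "well_positioned X N E p"
  from Xkl show "sparsity_counts X N V E p k l"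
    using sparsity_counts_UNIV[OF _ assms(3), of one N p l k]
      sparsity_counts_hermitian[OF _ assms(3), of one N p l k] adm fw full wp
      skew_dimensions_complex[OF assms(1)] n
    by auto
qed

end
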